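(* If $\kappa$ is a $\Pi^1_2$-indescribable cardinal (with $\kappa^{<\kappa}=\kappa$), then $E^{\kappa,\kappa}_{reg}$ is $\Sigma^1_1$-complete.
   Context: $\Pi^1_2$-indescribability is the usual notion. $\mathrm{reg}(\kappa)=\{\alpha<\kappa\mid\alpha\text{ regular cardinal}\}$. $\kappa^\kappa$ carries the bounded topology (basic open sets $[\zeta]=\{\eta\in\kappa^\kappa\mid\zeta\subset\eta\}$, $\zeta\in\kappa^{<\kappa}$). $E^{\kappa,\kappa}_{reg}=\{(\eta,\xi)\in\kappa^\kappa\times\kappa^\kappa\mid\{\alpha<\kappa\mid\eta(\alpha)\ne\xi(\alpha)\}\cap\mathrm{reg}(\kappa)\text{ is not stationary}\}$. Borel means $\kappa$-Borel (generated from basic open sets by unions and intersections of length $\kappa$); a function is Borel if preimages of open sets are Borel. An equivalence relation $E$ on $\kappa^\kappa$ is $\Sigma^1_1$ if it is the projection of a closed subset of $(\kappa^\kappa)^2\times\kappa^\kappa$; it is $\Sigma^1_1$-complete if it is $\Sigma^1_1$ and every $\Sigma^1_1$ equivalence relation $E'$ on $\kappa^\kappa$ is Borel reducible to it (there is a Borel $f$ with $\eta\,E'\,\xi\iff f(\eta)\,E\,f(\xi)$). *)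

theory Defs
  imports "HOL-Analysis.Product_Topology" "HOL-Library.Equipollence"
begin

text \<open>
  Throughout, the cardinal \<open>\<kappa>\<close> is a type \<open>'k\<close> of class \<open>wellorder\<close> whose order is a cardinal order.
  Elements of \<open>'k\<close> are the ordinals below \<open>\<kappa>\<close>, the ordinal \<open>\<alpha>\<close> is the initial segment \<open>{..<\<alpha>}\<close>, and
  \<open>\<kappa>\<^sup>\<kappa>\<close> is the function type \<open>'k \<Rightarrow> 'k\<close>.
\<close>

definition is_cardinal_type :: "'k::wellorder itself \<Rightarrow> bool" where
  "is_cardinal_type _ \<longleftrightarrow> card_order {(x::'k, y). x \<le> y}"

definition segment_order :: "'k::wellorder \<Rightarrow> ('k \<times> 'k) set" where
  "segment_order \<alpha> = {(x, y). x \<le> y \<and> y < \<alpha>}"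

definition reg :: "'k::wellorder set" where
  "reg = {\<alpha>. Card_order (segment_order \<alpha>) \<and> infinite {..<\<alpha>}
             \<and> regularCard (segment_order \<alpha>)}"


section \<open>Stationary sets\<close>

text \<open>The condition \<open>\<exists>\<beta>. \<beta> < \<alpha>\<close> excludes \<open>\<alpha> = 0\<close>; successor ordinals fail the second conjunct.\<close>

definition closed_in_ordinal :: "'k::wellorder set \<Rightarrow> bool" where
  "closed_in_ordinal C \<longleftrightarrow>
     (\<forall>\<alpha>. (\<exists>\<beta>. \<beta> < \<alpha>) \<and> (\<forall>\<beta><\<alpha>. \<exists>\<gamma>\<in>C. \<beta> < \<gamma> \<and> \<gamma> < \<alpha>) \<longrightarrow> \<alpha> \<in> C)"

definition unbounded :: "'k::wellorder set \<Rightarrow> bool" where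
  "unbounded C \<longleftrightarrow> (\<forall>\<alpha>. \<exists>\<beta>\<in>C. \<alpha> \<le> \<beta>)"

definition club :: "'k::wellorder set \<Rightarrow> bool" where
  "club C \<longleftrightarrow> closed_in_ordinal C \<and> unbounded C"

definition stationary :: "'k::wellorder set \<Rightarrow> bool" where
  "stationary S \<longleftrightarrow> (\<forall>C. club C \<longrightarrow> S \<inter> C \<noteq> {})"

definition E_reg :: "(('k::wellorder \<Rightarrow> 'k) \<times> ('k \<Rightarrow> 'k)) set" where
  "E_reg = {(\<eta>, \<xi>). \<not> stationary ({\<alpha>. \<eta> \<alpha> \<noteq> \<xi> \<alpha>} \<inter> reg)}"


section \<open>The generalized Baire space\<close>

text \<open>An element of \<open>\<kappa>\<close>-to-the-less-than-\<open>\<kappa>\<close> is a partial map whose domain is an ordinal below \<open>\<kappa>\<close>.\<close>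

definition short_seqs :: "('k::wellorder \<rightharpoonup> 'k) set" where
  "short_seqs = {\<zeta>. \<exists>\<beta>. dom \<zeta> = {..<\<beta>}}"

definition basic_open :: "('k \<rightharpoonup> 'k) \<Rightarrow> ('k::wellorder \<Rightarrow> 'k) set" where
  "basic_open \<zeta> = {\<eta>. \<zeta> \<subseteq>\<^sub>m (\<lambda>\<alpha>. Some (\<eta> \<alpha>))}"

definition bounded_topology :: "('k::wellorder \<Rightarrow> 'k) topology" where
  "bounded_topology = topology_generated_by (basic_open ` short_seqs)"

inductive_set kappa_borel :: "('k::wellorder \<Rightarrow> 'k) set set" where
  basic: "\<zeta> \<in> short_seqs \<Longrightarrow> basic_open \<zeta> \<in> kappa_borel"
| union: "(\<And>\<alpha>::'k. A \<alpha> \<in> kappa_borel) \<Longrightarrow> (\<Union>\<alpha>. A \<alpha>) \<in> kappa_borel"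
| inter: "(\<And>\<alpha>::'k. A \<alpha> \<in> kappa_borel) \<Longrightarrow> (\<Inter>\<alpha>. A \<alpha>) \<in> kappa_borel"

definition borel_function :: "(('k::wellorder \<Rightarrow> 'k) \<Rightarrow> ('k \<Rightarrow> 'k)) \<Rightarrow> bool" where
  "borel_function f \<longleftrightarrow> (\<forall>U. openin bounded_topology U \<longrightarrow> f -` U \<in> kappa_borel)"

definition borel_reducible ::
  "(('k::wellorder \<Rightarrow> 'k) \<times> ('k \<Rightarrow> 'k)) set \<Rightarrow> (('k \<Rightarrow> 'k) \<times> ('k \<Rightarrow> 'k)) set \<Rightarrow> bool" where
  "borel_reducible E' E \<longleftrightarrow>
     (\<exists>f. borel_function f \<and> (\<forall>\<eta> \<xi>. (\<eta>, \<xi>) \<in> E' \<longleftrightarrow> (f \<eta>, f \<xi>) \<in> E))"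

definition sigma11 :: "(('k::wellorder \<Rightarrow> 'k) \<times> ('k \<Rightarrow> 'k)) set \<Rightarrow> bool" where
  "sigma11 E \<longleftrightarrow>
     (\<exists>C :: ((('k \<Rightarrow> 'k) \<times> ('k \<Rightarrow> 'k)) \<times> ('k \<Rightarrow> 'k)) set.
        closedin (prod_topology (prod_topology bounded_topology bounded_topology) bounded_topology) C
        \<and> E = fst ` C)"

definition sigma11_complete :: "(('k::wellorder \<Rightarrow> 'k) \<times> ('k \<Rightarrow> 'k)) set \<Rightarrow> bool" where
  "sigma11_complete E \<longleftrightarrow>
     equiv UNIV E \<and> sigma11 E \<and>
     (\<forall>E'. equiv UNIV E' \<and> sigma11 E' \<longrightarrow> borel_reducible E' E)"


section \<open>The cumulative hierarchy\<close>

text \<open>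
  The type \<open>'v\<close> with \<open>elts\<close> (the membership relation is \<open>x \<in> elts y\<close>) is a copy of the set \<open>V\<^sub>\<kappa>\<close>, with
  levels \<open>V \<alpha>\<close> for \<open>\<alpha> < \<kappa>\<close>. The first conjunct is the recursion saying that \<open>V\<^sub>\<alpha>\<close> is the union of
  the power sets of \<open>V\<^sub>\<beta>\<close> for \<open>\<beta> < \<alpha>\<close>. The second says the same for \<open>V\<^sub>\<kappa>\<close>: sets are determined by
  their elements, and precisely the subsets of some \<open>V\<^sub>\<beta>\<close> with \<open>\<beta> < \<kappa>\<close> occur as sets. These conditions
  determine \<open>elts\<close> and \<open>V\<close> up to isomorphism. The type \<open>'v\<close> is a parameter because, for arbitrary
  \<open>\<kappa>\<close>, the size of \<open>V\<^sub>\<kappa>\<close> is not bounded by a type built from \<open>'k\<close>.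
\<close>

definition cumulative_hierarchy :: "('v \<Rightarrow> 'v set) \<Rightarrow> ('k::wellorder \<Rightarrow> 'v set) \<Rightarrow> bool" where
  "cumulative_hierarchy elts V \<longleftrightarrow>
     (\<forall>\<alpha>. V \<alpha> = {x. \<exists>\<beta><\<alpha>. elts x \<subseteq> V \<beta>}) \<and>
     bij_betw elts UNIV (\<Union>\<beta>. Pow (V \<beta>))"


section \<open>Second-order formulas and indescribability\<close>

text \<open>
  Formulas of second-order set theory with one additional unary predicate symbol \<open>R\<close>. First-order
  variables and (unary) second-order variables are separately indexed by natural numbers.
  \<open>InVar i j\<close> states that first-order variable \<open>i\<close> belongs to second-order variable \<open>j\<close>.
\<close>

datatype fm =
    Mem nat nat
  | Eq nat nat
  | InPred nat
  | InVar nat nat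
  | Neg fm
  | Conj fm fm
  | Forall1 nat fm
  | Forall2 nat fm

abbreviation Exists2 :: "nat \<Rightarrow> fm \<Rightarrow> fm" where
  "Exists2 i \<phi> \<equiv> Neg (Forall2 i (Neg \<phi>))"

text \<open>Satisfaction in the structure with domain \<open>M\<close>, membership given by \<open>elts\<close>, and predicate \<open>R\<close>.\<close>

primrec sat :: "('v \<Rightarrow> 'v set) \<Rightarrow> 'v set \<Rightarrow> 'v set \<Rightarrow> (nat \<Rightarrow> 'v) \<Rightarrow> (nat \<Rightarrow> 'v set) \<Rightarrow> fm \<Rightarrow> bool" where
  "sat elts M R e X (Mem i j) \<longleftrightarrow> e i \<in> elts (e j)"
| "sat elts M R e X (Eq i j) \<longleftrightarrow> e i = e j"
| "sat elts M R e X (InPred i) \<longleftrightarrow> e i \<in> R"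
| "sat elts M R e X (InVar i j) \<longleftrightarrow> e i \<in> X j"
| "sat elts M R e X (Neg \<phi>) \<longleftrightarrow> \<not> sat elts M R e X \<phi>"
| "sat elts M R e X (Conj \<phi> \<psi>) \<longleftrightarrow> sat elts M R e X \<phi> \<and> sat elts M R e X \<psi>"
| "sat elts M R e X (Forall1 i \<phi>) \<longleftrightarrow> (\<forall>x\<in>M. sat elts M R (e(i := x)) X \<phi>)"
| "sat elts M R e X (Forall2 i \<phi>) \<longleftrightarrow> (\<forall>A\<subseteq>M. sat elts M R e (X(i := A)) \<phi>)"

primrec free1 :: "fm \<Rightarrow> nat set" where
  "free1 (Mem i j) = {i, j}"
| "free1 (Eq i j) = {i, j}"
| "free1 (InPred i) = {i}"
| "free1 (InVar i j) = {i}"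
| "free1 (Neg \<phi>) = free1 \<phi>"
| "free1 (Conj \<phi> \<psi>) = free1 \<phi> \<union> free1 \<psi>"
| "free1 (Forall1 i \<phi>) = free1 \<phi> - {i}"
| "free1 (Forall2 i \<phi>) = free1 \<phi>"

primrec free2 :: "fm \<Rightarrow> nat set" where
  "free2 (Mem i j) = {}"
| "free2 (Eq i j) = {}"
| "free2 (InPred i) = {}"
| "free2 (InVar i j) = {j}"
| "free2 (Neg \<phi>) = free2 \<phi>"
| "free2 (Conj \<phi> \<psi>) = free2 \<phi> \<union> free2 \<psi>"
| "free2 (Forall1 i \<phi>) = free2 \<phi>"
| "free2 (Forall2 i \<phi>) = free2 \<phi> - {i}"

definition sentence :: "fm \<Rightarrow> bool" where
  "sentence \<phi> \<longleftrightarrow> free1 \<phi> = {} \<and> free2 \<phi> = {}"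

text \<open>
  For sentences the assignments are irrelevant; quantifying over all of them (with values not
  restricted to \<open>M\<close>) also gives the intended meaning when \<open>M\<close> is empty, as for \<open>V\<^sub>0\<close>.
\<close>

definition models :: "('v \<Rightarrow> 'v set) \<Rightarrow> 'v set \<Rightarrow> 'v set \<Rightarrow> fm \<Rightarrow> bool" where
  "models elts M R \<phi> \<longleftrightarrow> (\<forall>e X. sat elts M R e X \<phi>)"

primrec first_order :: "fm \<Rightarrow> bool" where
  "first_order (Mem i j) = True"
| "first_order (Eq i j) = True"
| "first_order (InPred i) = True"
| "first_order (InVar i j) = True"
| "first_order (Neg \<phi>) = first_order \<phi>"
| "first_order (Conj \<phi> \<psi>) = (first_order \<phi> \<and> first_order \<psi>)"
| "first_order (Forall1 i \<phi>) = first_order \<phi>"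
| "first_order (Forall2 i \<phi>) = False"

text \<open>
  The classes \<open>\<Pi>\<^sup>1\<^sub>n\<close> and \<open>\<Sigma>\<^sup>1\<^sub>n\<close>: at most \<open>n\<close> alternating blocks of second-order quantifiers followed by
  a formula without second-order quantifiers.
\<close>

inductive pi1 :: "nat \<Rightarrow> fm \<Rightarrow> bool" and sigma1 :: "nat \<Rightarrow> fm \<Rightarrow> bool" where
  pi1_base: "first_order \<phi> \<Longrightarrow> pi1 0 \<phi>"
| sigma1_base: "first_order \<phi> \<Longrightarrow> sigma1 0 \<phi>"
| pi1_incl: "sigma1 n \<phi> \<Longrightarrow> pi1 (Suc n) \<phi>"
| pi1_all: "pi1 (Suc n) \<phi> \<Longrightarrow> pi1 (Suc n) (Forall2 i \<phi>)"
| sigma1_incl: "pi1 n \<phi> \<Longrightarrow> sigma1 (Suc n) \<phi>"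
| sigma1_ex: "sigma1 (Suc n) \<phi> \<Longrightarrow> sigma1 (Suc n) (Exists2 i \<phi>)"

definition pi1_indescribable ::
  "nat \<Rightarrow> ('v \<Rightarrow> 'v set) \<Rightarrow> ('k::wellorder \<Rightarrow> 'v set) \<Rightarrow> bool" where
  "pi1_indescribable n elts V \<longleftrightarrow>
     (\<forall>R \<phi>. sentence \<phi> \<and> pi1 n \<phi> \<and> models elts UNIV R \<phi>
        \<longrightarrow> (\<exists>\<alpha>. models elts (V \<alpha>) (R \<inter> V \<alpha>) \<phi>))"

end

theory Submission
  imports Defs
begin

text \<open>
  Let \<open>E\<close> be the projection of a closed set, given by a tree \<open>T\<close> of triples of short sequences, and code short
  sequences by ordinals below \<open>\<kappa>\<close>. For \<open>\<alpha> < \<kappa>\<close> let \<open>f \<sim>\<^sub>\<alpha> g\<close> mean that some \<open>h : \<alpha> \<rightarrow> \<alpha>\<close> is such that all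
  restrictions of \<open>(f, g, h)\<close> to ordinals below \<open>\<alpha>\<close> have codes below \<open>\<alpha>\<close> and belong to \<open>T\<close>. The reduction maps \<open>\<eta>\<close>
  to the function that sends \<open>\<alpha>\<close> to the code of a chosen representative of the \<open>\<sim>\<^sub>\<alpha>\<close>-class of \<open>\<eta>\<close> restricted to
  \<open>\<alpha>\<close>, whenever \<open>\<sim>\<^sub>\<alpha>\<close> is an equivalence relation on the functions from \<open>\<alpha>\<close> to \<open>\<alpha>\<close> and \<open>\<eta>\<close> maps \<open>\<alpha>\<close> to \<open>\<alpha>\<close>.

  If \<open>\<eta> E \<xi>\<close>, the images agree at every \<open>\<alpha>\<close> closed under \<open>\<eta>\<close>, \<open>\<xi>\<close>, a witness and their coding functions. Otherwise
  the statement that \<open>\<sim>\<close> is an equivalence relation (\<open>\<Pi>\<^sup>1\<^sub>2\<close>) with \<open>\<eta> \<sim> \<xi>\<close> false (\<open>\<Pi>\<^sup>1\<^sub>1\<close>) reflects to some \<open>\<alpha>\<close> closed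
  under any prescribed function. At such an \<open>\<alpha>\<close> every function from a smaller ordinal to \<open>\<alpha>\<close> has a code below \<open>\<alpha>\<close>,
  so a diagonal argument shows that \<open>\<alpha>\<close> is a regular cardinal, and the images of \<open>\<eta>\<close> and \<open>\<xi>\<close> differ at \<open>\<alpha>\<close>.
\<close>

section \<open>Formulas\<close>

definition Exists1 :: "nat \<Rightarrow> fm \<Rightarrow> fm" where
  "Exists1 i \<phi> = Neg (Forall1 i (Neg \<phi>))"

definition Imp :: "fm \<Rightarrow> fm \<Rightarrow> fm" where
  "Imp \<phi> \<psi> = Neg (Conj \<phi> (Neg \<psi>))"

definition Iff :: "fm \<Rightarrow> fm \<Rightarrow> fm" where
  "Iff \<phi> \<psi> = Conj (Imp \<phi> \<psi>) (Imp \<psi> \<phi>)"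

lemma sat_connectives [simp]:
  "sat elts M R e X (Exists1 i \<phi>) \<longleftrightarrow> (\<exists>x\<in>M. sat elts M R (e(i := x)) X \<phi>)"
  "sat elts M R e X (Imp \<phi> \<psi>) \<longleftrightarrow> (sat elts M R e X \<phi> \<longrightarrow> sat elts M R e X \<psi>)"
  "sat elts M R e X (Iff \<phi> \<psi>) \<longleftrightarrow> (sat elts M R e X \<phi> \<longleftrightarrow> sat elts M R e X \<psi>)"
  by (auto simp: Exists1_def Imp_def Iff_def)

lemma free_connectives [simp]:
  "free1 (Exists1 i \<phi>) = free1 \<phi> - {i}" "free2 (Exists1 i \<phi>) = free2 \<phi>"
  "free1 (Imp \<phi> \<psi>) = free1 \<phi> \<union> free1 \<psi>" "free2 (Imp \<phi> \<psi>) = free2 \<phi> \<union> free2 \<psi>"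
  "free1 (Iff \<phi> \<psi>) = free1 \<phi> \<union> free1 \<psi>" "free2 (Iff \<phi> \<psi>) = free2 \<phi> \<union> free2 \<psi>"
  "first_order (Exists1 i \<phi>) \<longleftrightarrow> first_order \<phi>"
  "first_order (Imp \<phi> \<psi>) \<longleftrightarrow> first_order \<phi> \<and> first_order \<psi>"
  "first_order (Iff \<phi> \<psi>) \<longleftrightarrow> first_order \<phi> \<and> first_order \<psi>"
  by (auto simp: Exists1_def Imp_def Iff_def)

lemma sat_cong_free:
  assumes "\<And>i. i \<in> free1 \<phi> \<Longrightarrow> e i = e' i" "\<And>j. j \<in> free2 \<phi> \<Longrightarrow> X j = X' j"
  shows "sat elts M R e X \<phi> \<longleftrightarrow> sat elts M R e' X' \<phi>"
  using assms
proof (induction \<phi> arbitrary: e e' X X')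
  case (Conj \<phi> \<psi>)
  have "sat elts M R e X \<phi> \<longleftrightarrow> sat elts M R e' X' \<phi>" "sat elts M R e X \<psi> \<longleftrightarrow> sat elts M R e' X' \<psi>"
    by (rule Conj.IH; simp add: Conj.prems)+
  then show ?case by simp
next
  case (Forall1 i \<phi>)
  have "sat elts M R (e(i := x)) X \<phi> \<longleftrightarrow> sat elts M R (e'(i := x)) X' \<phi>" for x
    by (rule Forall1.IH) (auto simp: Forall1.prems)
  then show ?case by simp
next
  case (Forall2 i \<phi>)
  have "sat elts M R e (X(i := A)) \<phi> \<longleftrightarrow> sat elts M R e' (X'(i := A)) \<phi>" for A
    by (rule Forall2.IH) (auto simp: Forall2.prems)
  then show ?case by simp
next
  case (Neg \<phi>)
  have "sat elts M R e X \<phi> \<longleftrightarrow> sat elts M R e' X' \<phi>"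
    by (rule Neg.IH; simp add: Neg.prems)
  then show ?case by simp
qed auto

lemma models_iff_sat: "sentence \<phi> \<Longrightarrow> models elts M R \<phi> \<longleftrightarrow> sat elts M R e X \<phi>"
  unfolding models_def sentence_def using sat_cong_free[of \<phi>] by blast

text \<open>Bound variables in this formula and in those down to \<open>GrF\<close> have indices
  above those of the free ones, which rules out capture.\<close>

definition UpairF :: "nat \<Rightarrow> nat \<Rightarrow> nat \<Rightarrow> fm" where
  "UpairF k i j = (let z = Suc (i + j + k) in
     Forall1 z (Iff (Mem z k) (Neg (Conj (Neg (Eq z i)) (Neg (Eq z j))))))"

definition KpairF :: "nat \<Rightarrow> nat \<Rightarrow> nat \<Rightarrow> fm" where
  "KpairF k i j = (let u = Suc (i + j + k); v = Suc u in
     Exists1 u (Exists1 v (Conj (UpairF u i i) (Conj (UpairF v i j) (UpairF k u v)))))"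

text \<open>Zermelo numerals, with n + 1 = {n}. They serve as tags for the relations packed into the
  predicate.\<close>

primrec NumF :: "nat \<Rightarrow> nat \<Rightarrow> fm" where
  "NumF 0 i = Forall1 (Suc i) (Neg (Mem (Suc i) i))"
| "NumF (Suc n) i = Exists1 (Suc i) (Conj (UpairF i (Suc i) (Suc i)) (NumF n (Suc i)))"

text \<open>The language offers one unary predicate, so a sequence of ternary relations is stored in
  it as tagged quadruples. A binary relation is queried with its second argument repeated.\<close>

definition RelF :: "nat \<Rightarrow> nat \<Rightarrow> nat \<Rightarrow> nat \<Rightarrow> fm" where
  "RelF n i j k = (let t = Suc (i + j + k); p = Suc t; q = Suc p; r = Suc q in
     Exists1 t (Exists1 p (Exists1 q (Exists1 r
       (Conj (NumF n t) (Conj (KpairF p j k) (Conj (KpairF q i p) (Conj (KpairF r t q) (InPred r)))))))))"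

definition GrF :: "nat \<Rightarrow> nat \<Rightarrow> nat \<Rightarrow> fm" where
  "GrF A i j = (let p = Suc (i + j) in Exists1 p (Conj (KpairF p i j) (InVar p A)))"

text \<open>Relation 0 is going to hold exactly of ordinals, which makes this and \<open>ExO\<close>
  the quantifiers over ordinals.\<close>

definition AllO :: "nat \<Rightarrow> fm \<Rightarrow> fm" where
  "AllO i \<phi> = Forall1 i (Imp (RelF 0 i i i) \<phi>)"

definition ExO :: "nat \<Rightarrow> fm \<Rightarrow> fm" where
  "ExO i \<phi> = Exists1 i (Conj (RelF 0 i i i) \<phi>)"

lemma first_order_NumF [simp]: "first_order (NumF n i)"
  by (induction n arbitrary: i) (auto simp: UpairF_def Let_def)

lemma free_NumF: "free1 (NumF n i) \<subseteq> {i}" "free2 (NumF n i) = {}"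
  by (induction n arbitrary: i) (auto simp: UpairF_def Let_def)

lemma first_order_macros [simp]:
  "first_order (UpairF k i j)" "first_order (KpairF k i j)" "first_order (RelF n i j k)"
  "first_order (GrF A i j)" "first_order (AllO i \<phi>) \<longleftrightarrow> first_order \<phi>"
  "first_order (ExO i \<phi>) \<longleftrightarrow> first_order \<phi>"
  by (auto simp: UpairF_def KpairF_def RelF_def GrF_def AllO_def ExO_def Let_def)

lemma free1_KpairF [simp]: "free1 (KpairF k i j) = {k, i, j}"
  unfolding KpairF_def UpairF_def Let_def by auto

lemma free1_RelF [simp]: "free1 (RelF n i j k) = {i, j, k}"
proof -
  have "free1 (RelF n i j k) = {i, j, k} \<union> (free1 (NumF n (Suc (i+j+k))) - {Suc (i+j+k)})"
    using free_NumF(1)[of n "Suc (i+j+k)"] unfolding RelF_def Let_def by auto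
  then show ?thesis using free_NumF(1)[of n "Suc (i+j+k)"] by blast
qed

lemma free2_KpairF [simp]: "free2 (KpairF k i j) = {}"
  by (simp add: KpairF_def UpairF_def Let_def)

lemma free2_RelF [simp]: "free2 (RelF n i j k) = {}"
  by (simp add: RelF_def Let_def free_NumF)

lemma free_GrF [simp]: "free1 (GrF A i j) = {i, j}" "free2 (GrF A i j) = {A}"
  by (auto simp: GrF_def Let_def)

lemma free_quantifiers [simp]:
  "free1 (AllO i \<phi>) = free1 \<phi> - {i}" "free1 (ExO i \<phi>) = free1 \<phi> - {i}"
  "free2 (AllO i \<phi>) = free2 \<phi>" "free2 (ExO i \<phi>) = free2 \<phi>"
  by (auto simp: AllO_def ExO_def)

section \<open>The cumulative hierarchy\<close>

locale hierarchy =
  fixes elts :: "'v \<Rightarrow> 'v set" and V :: "'k::wellorder \<Rightarrow> 'v set"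
  assumes cumulative: "cumulative_hierarchy elts V"
    and no_max: "\<And>\<alpha>::'k. \<exists>\<beta>. \<alpha> < \<beta>"
begin

definition mk :: "'v set \<Rightarrow> 'v" where
  "mk S = inv elts S"

lemma V_iff: "x \<in> V \<alpha> \<longleftrightarrow> (\<exists>\<beta><\<alpha>. elts x \<subseteq> V \<beta>)"
  using cumulative unfolding cumulative_hierarchy_def by blast

lemma elts_inject [simp]: "elts x = elts y \<longleftrightarrow> x = y"
  using cumulative unfolding cumulative_hierarchy_def bij_betw_def inj_on_def by blast

lemma elts_mk: "S \<subseteq> V \<beta> \<Longrightarrow> elts (mk S) = S"
  using cumulative unfolding cumulative_hierarchy_def bij_betw_def mk_def
  by (intro f_inv_into_f) blast

lemma V_mono: "\<alpha> \<le> \<beta> \<Longrightarrow> V \<alpha> \<subseteq> V \<beta>"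
  using V_iff by (meson less_le_trans subsetI)

lemma ex_V: "\<exists>\<beta>. x \<in> V \<beta>"
proof -
  have "elts x \<in> (\<Union>\<beta>. Pow (V \<beta>))"
    using cumulative unfolding cumulative_hierarchy_def bij_betw_def by blast
  then show ?thesis using no_max V_iff by blast
qed

text \<open>\<open>V \<alpha>\<close> itself serves as the ordinal \<open>\<alpha>\<close>: its rank is \<open>\<alpha>\<close>, and membership is the order.\<close>

definition ord :: "'k \<Rightarrow> 'v" where
  "ord \<alpha> = mk (V \<alpha>)"

lemma elts_ord: "elts (ord \<alpha>) = V \<alpha>"
  unfolding ord_def by (rule elts_mk[OF subset_refl])

text \<open>Otherwise V \<alpha> would be included in an earlier V \<beta>. But
  \<open>ord \<beta>\<close> lies in V \<alpha>, hence would lie in V \<beta>, against the induction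
  hypothesis.\<close>

lemma ord_notin_V: "ord \<alpha> \<notin> V \<alpha>"
proof (induction \<alpha> rule: less_induct)
  case (less \<alpha>)
  show ?case
  proof
    assume "ord \<alpha> \<in> V \<alpha>"
    then obtain \<beta> where "\<beta> < \<alpha>" "V \<alpha> \<subseteq> V \<beta>" by (auto simp: V_iff[of "ord \<alpha>"] elts_ord)
    moreover from this have "ord \<beta> \<in> V \<alpha>" by (auto simp: V_iff[of "ord \<beta>"] elts_ord)
    ultimately show False using less.IH by blast
  qed
qed

lemma ord_in_V [simp]: "ord \<alpha> \<in> V \<beta> \<longleftrightarrow> \<alpha> < \<beta>"
proof
  assume "ord \<alpha> \<in> V \<beta>"
  then show "\<alpha> < \<beta>" using ord_notin_V V_mono by (meson not_less subsetD)
qed (auto simp: V_iff elts_ord)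

lemma ord_Mem [simp]: "ord \<alpha> \<in> elts (ord \<beta>) \<longleftrightarrow> \<alpha> < \<beta>"
  by (simp add: elts_ord)

lemma ord_inject [simp]: "ord \<alpha> = ord \<beta> \<longleftrightarrow> \<alpha> = \<beta>"
  by (metis ord_in_V neq_iff order_less_irrefl)

definition upair :: "'v \<Rightarrow> 'v \<Rightarrow> 'v" where
  "upair x y = mk {x, y}"

definition kpair :: "'v \<Rightarrow> 'v \<Rightarrow> 'v" where
  "kpair x y = upair (upair x x) (upair x y)"

lemma elts_upair [simp]: "elts (upair x y) = {x, y}"
proof -
  obtain \<beta> \<gamma> where "x \<in> V \<beta>" "y \<in> V \<gamma>" using ex_V by metis
  then have "{x, y} \<subseteq> V (max \<beta> \<gamma>)"
    using V_mono[of \<beta> "max \<beta> \<gamma>"] V_mono[of \<gamma> "max \<beta> \<gamma>"] by auto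
  then show ?thesis by (simp add: upair_def elts_mk)
qed

lemma upair_eq_iff: "z = upair x y \<longleftrightarrow> elts z = {x, y}"
  by (metis elts_inject elts_upair)

lemma kpair_inject [simp]: "kpair x y = kpair x' y' \<longleftrightarrow> x = x' \<and> y = y'"
  unfolding kpair_def upair_eq_iff[of "upair _ _"] by (auto simp: upair_eq_iff doubleton_eq_iff)

primrec num :: "nat \<Rightarrow> 'v" where
  "num 0 = mk {}"
| "num (Suc n) = upair (num n) (num n)"

lemma elts_num_0 [simp]: "elts (mk {}) = {}"
  by (rule elts_mk[of _ undefined]) simp

lemma num_inject [simp]: "num m = num n \<longleftrightarrow> m = n"
proof (induction m arbitrary: n)
  case 0
  show ?case by (cases n) (auto simp flip: elts_inject)
next
  case (Suc m)
  then show ?case by (cases n) (auto simp flip: elts_inject)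
qed

definition code :: "nat \<Rightarrow> 'v \<Rightarrow> 'v \<Rightarrow> 'v \<Rightarrow> 'v" where
  "code n x y z = kpair (num n) (kpair x (kpair y z))"

text \<open>Relation 0 is replaced by the full relation, so that it defines the range of \<open>ord\<close>.\<close>

definition pred_of :: "(nat \<Rightarrow> 'k \<Rightarrow> 'k \<Rightarrow> 'k \<Rightarrow> bool) \<Rightarrow> 'v set" where
  "pred_of Q = {code n (ord \<alpha>) (ord \<beta>) (ord \<gamma>) | n \<alpha> \<beta> \<gamma>. n = 0 \<or> Q n \<alpha> \<beta> \<gamma>}"

text \<open>What the evaluation of the formulas requires of a structure. The whole universe and the
  levels at nonzero limits both satisfy it, so truth is computed once for both.\<close>

definition domain :: "'v set \<Rightarrow> 'k set \<Rightarrow> bool" where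
  "domain M I \<longleftrightarrow> (\<forall>x\<in>M. elts x \<subseteq> M) \<and> (\<forall>x\<in>M. \<forall>y\<in>M. upair x y \<in> M) \<and> mk {} \<in> M
      \<and> (\<forall>\<alpha>. ord \<alpha> \<in> M \<longleftrightarrow> \<alpha> \<in> I)"

lemma domain_UNIV: "domain UNIV UNIV"
  by (simp add: domain_def)

text \<open>At a limit, two elements of the level already occur in a common earlier level, so their
  pair is in the level.\<close>

lemma domain_V:
  assumes "\<exists>\<beta>. \<beta> < \<alpha>" and lim: "\<And>\<beta>. \<beta> < \<alpha> \<Longrightarrow> \<exists>\<gamma><\<alpha>. \<beta> < \<gamma>"
  shows "domain (V \<alpha>) {..<\<alpha>}"
proof -
  have below: "\<exists>\<beta><\<alpha>. x \<in> V \<beta>" if x: "x \<in> V \<alpha>" for x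
  proof -
    obtain \<beta> where "\<beta> < \<alpha>" "elts x \<subseteq> V \<beta>" using x by (auto simp: V_iff[of x])
    moreover from lim[OF this(1)] obtain \<gamma> where "\<gamma> < \<alpha>" "\<beta> < \<gamma>" by blast
    ultimately show ?thesis by (auto simp: V_iff[of x])
  qed
  have "upair x y \<in> V \<alpha>" if x: "x \<in> V \<alpha>" and y: "y \<in> V \<alpha>" for x y
  proof -
    obtain \<beta> \<gamma> where "\<beta> < \<alpha>" "x \<in> V \<beta>" "\<gamma> < \<alpha>" "y \<in> V \<gamma>" using below[OF x] below[OF y] by blast
    then have "{x, y} \<subseteq> V (max \<beta> \<gamma>)" "max \<beta> \<gamma> < \<alpha>"
      using V_mono[of \<beta> "max \<beta> \<gamma>"] V_mono[of \<gamma> "max \<beta> \<gamma>"] by auto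
    then show ?thesis unfolding V_iff[of "upair x y"] elts_upair by blast
  qed
  moreover have "elts x \<subseteq> V \<alpha>" if "x \<in> V \<alpha>" for x
    using that V_iff V_mono by (meson order_less_imp_le subset_trans)
  moreover have "mk {} \<in> V \<alpha>" using assms(1) by (auto simp: V_iff)
  ultimately show ?thesis by (simp add: domain_def)
qed

end

section \<open>Satisfaction in the universe and in its limit levels\<close>

locale level = hierarchy +
  fixes M I Q R
  assumes dom: "domain M I" and R: "R = pred_of Q \<inter> M"
begin

lemma M_closed:
  "x \<in> M \<Longrightarrow> z \<in> elts x \<Longrightarrow> z \<in> M" "x \<in> M \<Longrightarrow> y \<in> M \<Longrightarrow> upair x y \<in> M"
  "x \<in> M \<Longrightarrow> y \<in> M \<Longrightarrow> kpair x y \<in> M" "ord \<alpha> \<in> M \<longleftrightarrow> \<alpha> \<in> I"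
  using dom unfolding domain_def kpair_def by blast+

lemma num_in_M: "num n \<in> M"
  by (induction n) (use dom in \<open>auto simp: domain_def\<close>)

lemma sat_UpairF [simp]:
  assumes "e k \<in> M" "e i \<in> M" "e j \<in> M"
  shows "sat elts M R e X (UpairF k i j) \<longleftrightarrow> e k = upair (e i) (e j)"
  using assms M_closed(1)[OF assms(1)] by (auto simp: UpairF_def Let_def upair_eq_iff)

lemma sat_KpairF [simp]:
  assumes "e k \<in> M" "e i \<in> M" "e j \<in> M"
  shows "sat elts M R e X (KpairF k i j) \<longleftrightarrow> e k = kpair (e i) (e j)"
  using assms by (auto simp: KpairF_def Let_def kpair_def M_closed(2))

lemma sat_NumF [simp]:
  assumes "e i \<in> M"
  shows "sat elts M R e X (NumF n i) \<longleftrightarrow> e i = num n"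
  using assms
proof (induction n arbitrary: i e)
  case 0
  have "e i = mk {} \<longleftrightarrow> elts (e i) = {}" by (metis elts_inject elts_num_0)
  then show ?case using 0 M_closed(1) by auto
next
  case (Suc n)
  then show ?case by (auto simp: num_in_M)
qed

text \<open>Codes of elements of M are again in M, so cutting the predicate down to M loses
  nothing.\<close>

lemma sat_RelF:
  assumes "e i \<in> M" "e j \<in> M" "e k \<in> M"
  shows "sat elts M R e X (RelF n i j k) \<longleftrightarrow> code n (e i) (e j) (e k) \<in> pred_of Q"
proof -
  have "code n (e i) (e j) (e k) \<in> M" unfolding code_def using assms by (simp add: M_closed(2-4) num_in_M)
  moreover have "x \<in> R \<longleftrightarrow> x \<in> pred_of Q \<and> x \<in> M" for x by (simp add: R)
  ultimately show ?thesis
    using assms by (auto simp: RelF_def Let_def code_def M_closed(2-4) num_in_M)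
qed

lemma sat_RelF_0:
  assumes "e i \<in> M"
  shows "sat elts M R e X (RelF 0 i i i) \<longleftrightarrow> e i \<in> ord ` I"
proof
  assume "sat elts M R e X (RelF 0 i i i)"
  then have "code 0 (e i) (e i) (e i) \<in> pred_of Q" using assms by (simp add: sat_RelF)
  then obtain \<alpha> where "e i = ord \<alpha>" by (auto simp: pred_of_def code_def)
  then show "e i \<in> ord ` I" using assms by (simp add: M_closed(4))
next
  assume "e i \<in> ord ` I"
  then obtain \<alpha> where "e i = ord \<alpha>" by blast
  then have "code 0 (e i) (e i) (e i) \<in> pred_of Q"
    unfolding pred_of_def
    by (intro CollectI exI[of _ 0] exI[of _ \<alpha>]) simp
  then show "sat elts M R e X (RelF 0 i i i)" using assms by (simp add: sat_RelF)
qed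

text \<open>Assignments of the form \<open>ord \<circ> e\<close> let formulas about ordinals be
  simplified to statements about \<open>'k\<close>. Index 0 is excluded because
  \<open>pred_of\<close> overrides that relation.\<close>

lemma sat_RelF_ord [simp]:
  assumes "e i \<in> I" "e j \<in> I" "e k \<in> I" "n \<noteq> 0"
  shows "sat elts M R (ord \<circ> e) X (RelF n i j k) \<longleftrightarrow> Q n (e i) (e j) (e k)"
  using assms by (simp add: sat_RelF M_closed(2-4)) (auto simp: pred_of_def code_def)

lemma sat_GrF_ord [simp]:
  assumes "e i \<in> I" "e j \<in> I"
  shows "sat elts M R (ord \<circ> e) X (GrF A i j) \<longleftrightarrow> kpair (ord (e i)) (ord (e j)) \<in> X A"
  using assms by (auto simp: GrF_def Let_def M_closed(2-4))

lemma sat_AllO [simp]: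
  "sat elts M R (ord \<circ> e) X (AllO i \<phi>) \<longleftrightarrow> (\<forall>\<alpha>\<in>I. sat elts M R (ord \<circ> e(i := \<alpha>)) X \<phi>)"
proof -
  have "sat elts M R (ord \<circ> e) X (AllO i \<phi>)
      \<longleftrightarrow> (\<forall>x\<in>M. x \<in> ord ` I \<longrightarrow> sat elts M R ((ord \<circ> e)(i := x)) X \<phi>)"
    by (auto simp: AllO_def sat_RelF_0)
  also have "\<dots> \<longleftrightarrow> (\<forall>\<alpha>\<in>I. sat elts M R (ord \<circ> e(i := \<alpha>)) X \<phi>)"
    by (auto simp: M_closed(2-4) fun_upd_comp)
  finally show ?thesis .
qed

lemma sat_ExO [simp]:
  "sat elts M R (ord \<circ> e) X (ExO i \<phi>) \<longleftrightarrow> (\<exists>\<alpha>\<in>I. sat elts M R (ord \<circ> e(i := \<alpha>)) X \<phi>)"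
proof -
  have "sat elts M R (ord \<circ> e) X (ExO i \<phi>)
      \<longleftrightarrow> (\<exists>x\<in>M. x \<in> ord ` I \<and> sat elts M R ((ord \<circ> e)(i := x)) X \<phi>)"
    by (auto simp: ExO_def sat_RelF_0)
  also have "\<dots> \<longleftrightarrow> (\<exists>\<alpha>\<in>I. sat elts M R (ord \<circ> e(i := \<alpha>)) X \<phi>)"
    by (auto simp: M_closed(2-4) fun_upd_comp)
  finally show ?thesis .
qed

end

section \<open>Reflecting equivalence relations\<close>

definition maps :: "'k set \<Rightarrow> ('k \<Rightarrow> 'k) \<Rightarrow> bool" where
  "maps I f \<longleftrightarrow> f ` I \<subseteq> I"

text \<open>A second-order variable yields a binary relation, of which a level sees only the part on
  I. This is the first-order form of being a function from I to I; \<open>agree\<close> links it to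
  an actual function.\<close>

definition isfun :: "'k set \<Rightarrow> ('k \<Rightarrow> 'k \<Rightarrow> bool) \<Rightarrow> bool" where
  "isfun I G \<longleftrightarrow> (\<forall>\<beta>\<in>I. \<exists>\<gamma>\<in>I. G \<beta> \<gamma>) \<and> (\<forall>\<beta>\<in>I. \<forall>\<gamma>\<in>I. \<forall>\<delta>\<in>I. G \<beta> \<gamma> \<and> G \<beta> \<delta> \<longrightarrow> \<gamma> = \<delta>)"

definition agree :: "'k set \<Rightarrow> ('k \<Rightarrow> 'k \<Rightarrow> bool) \<Rightarrow> ('k \<Rightarrow> 'k) \<Rightarrow> bool" where
  "agree I G f \<longleftrightarrow> (\<forall>\<beta>\<in>I. \<forall>\<gamma>\<in>I. G \<beta> \<gamma> \<longleftrightarrow> f \<beta> = \<gamma>)"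

text \<open>\<open>D s \<gamma> \<delta>\<close> says that the sequence coded by \<open>s\<close> has value \<open>\<delta>\<close> at \<open>\<gamma>\<close>. Inside a level of the hierarchy
  only values in \<open>I\<close> are visible, so \<open>s\<close> need only look like the restriction of \<open>G\<close> to \<open>\<beta>\<close> from there.\<close>

definition seg :: "'k set \<Rightarrow> ('k::wellorder \<Rightarrow> 'k \<Rightarrow> 'k \<Rightarrow> bool) \<Rightarrow> 'k \<Rightarrow> 'k \<Rightarrow> ('k \<Rightarrow> 'k \<Rightarrow> bool) \<Rightarrow> bool" where
  "seg I D s \<beta> G \<longleftrightarrow> (\<forall>\<gamma>\<in>I. \<forall>\<delta>\<in>I. D s \<gamma> \<delta> \<longleftrightarrow> \<gamma> < \<beta> \<and> G \<gamma> \<delta>)"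

text \<open>The first-order matrix: (F, G, H) is a branch through the tree T, each of its initial
  segments being represented by codes in I.\<close>

definition wit :: "'k set \<Rightarrow> ('k::wellorder \<Rightarrow> 'k \<Rightarrow> 'k \<Rightarrow> bool) \<Rightarrow> ('k \<Rightarrow> 'k \<Rightarrow> 'k \<Rightarrow> bool)
    \<Rightarrow> ('k \<Rightarrow> 'k \<Rightarrow> bool) \<Rightarrow> ('k \<Rightarrow> 'k \<Rightarrow> bool) \<Rightarrow> ('k \<Rightarrow> 'k \<Rightarrow> bool) \<Rightarrow> bool" where
  "wit I D T F G H \<longleftrightarrow> (\<forall>\<beta>\<in>I. \<exists>s\<in>I. \<exists>t\<in>I. \<exists>u\<in>I. seg I D s \<beta> F \<and> seg I D t \<beta> G \<and> seg I D u \<beta> H \<and> T s t u)"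

abbreviation (input) graph :: "('k \<Rightarrow> 'k) \<Rightarrow> 'k \<Rightarrow> 'k \<Rightarrow> bool" where
  "graph f \<equiv> \<lambda>\<beta> \<gamma>. f \<beta> = \<gamma>"

definition sim :: "'k set \<Rightarrow> ('k::wellorder \<Rightarrow> 'k \<Rightarrow> 'k \<Rightarrow> bool) \<Rightarrow> ('k \<Rightarrow> 'k \<Rightarrow> 'k \<Rightarrow> bool)
    \<Rightarrow> ('k \<Rightarrow> 'k) \<Rightarrow> ('k \<Rightarrow> 'k) \<Rightarrow> bool" where
  "sim I D T f g \<longleftrightarrow> (\<exists>h. maps I h \<and> wit I D T (graph f) (graph g) (graph h))"

text \<open>The second condition is the Euclidean property. With reflexivity it yields symmetry and
  transitivity, so two clauses suffice in the sentence.\<close>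

definition equiv_at :: "'k set \<Rightarrow> ('k::wellorder \<Rightarrow> 'k \<Rightarrow> 'k \<Rightarrow> bool) \<Rightarrow> ('k \<Rightarrow> 'k \<Rightarrow> 'k \<Rightarrow> bool) \<Rightarrow> bool" where
  "equiv_at I D T \<longleftrightarrow> (\<forall>f. maps I f \<longrightarrow> sim I D T f f) \<and>
     (\<forall>f g h. maps I f \<and> maps I g \<and> maps I h \<and> sim I D T f g \<and> sim I D T h g \<longrightarrow> sim I D T f h)"

lemma isfun_iff: "isfun I G \<longleftrightarrow> (\<exists>f. maps I f \<and> agree I G f)"
proof
  assume "isfun I G"
  then have "\<forall>\<beta>. \<exists>\<gamma>. \<beta> \<in> I \<longrightarrow> \<gamma> \<in> I \<and> G \<beta> \<gamma>" unfolding isfun_def by blast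
  then obtain f where "\<forall>\<beta>\<in>I. f \<beta> \<in> I \<and> G \<beta> (f \<beta>)" by metis
  then have "maps I f \<and> agree I G f"
    using \<open>isfun I G\<close> unfolding isfun_def maps_def agree_def by blast
  then show "\<exists>f. maps I f \<and> agree I G f" by blast
next
  assume "\<exists>f. maps I f \<and> agree I G f"
  then show "isfun I G" unfolding isfun_def maps_def agree_def by (metis image_subset_iff)
qed

lemma seg_agree: "agree I G f \<Longrightarrow> seg I D s \<beta> G \<longleftrightarrow> seg I D s \<beta> (graph f)"
  unfolding agree_def seg_def by blast

lemma wit_agree:
  assumes "agree I F f" "agree I G g" "agree I H h"
  shows "wit I D T F G H \<longleftrightarrow> wit I D T (graph f) (graph g) (graph h)"
  unfolding wit_def by (simp add: assms[THEN seg_agree])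

section \<open>The sentence to be reflected\<close>

definition FunF :: "nat \<Rightarrow> fm" where
  "FunF A = Conj (AllO 0 (ExO 1 (GrF A 0 1)))
     (AllO 0 (AllO 1 (AllO 2 (Imp (Conj (GrF A 0 1) (GrF A 0 2)) (Eq 1 2)))))"

text \<open>First-order variable 0 holds the bound \<open>\<beta>\<close> of the segment.\<close>

definition SegF :: "nat \<Rightarrow> nat \<Rightarrow> fm" where
  "SegF s A = AllO 4 (AllO 5 (Iff (RelF 1 s 4 5) (Conj (Mem 4 0) (GrF A 4 5))))"

definition WitF :: "nat \<Rightarrow> nat \<Rightarrow> nat \<Rightarrow> fm" where
  "WitF A B C = AllO 0 (ExO 1 (ExO 2 (ExO 3
     (Conj (SegF 1 A) (Conj (SegF 2 B) (Conj (SegF 3 C) (RelF 2 1 2 3)))))))"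

definition GraphF :: "nat \<Rightarrow> nat \<Rightarrow> fm" where
  "GraphF n A = AllO 0 (AllO 1 (Iff (RelF n 0 1 1) (GrF A 0 1)))"

definition ClosF :: "nat \<Rightarrow> fm" where
  "ClosF n = AllO 0 (ExO 1 (RelF n 0 1 1))"

text \<open>Makes a reflecting \<alpha> a nonzero limit. It uses plain quantifiers because those
  over ordinals can be evaluated only in a structure closed under pairs.\<close>

definition LimF :: fm where
  "LimF = Conj (Exists1 0 (Eq 0 0)) (Forall1 0 (Exists1 1 (Mem 0 1)))"

text \<open>Second-order variables 0, 1, 2 are the functions to be compared, 3 and 4 given witnesses, 5 and 6 the
  witnesses that have to exist. Relations 3 and 4 of the predicate are the graphs of the two inequivalent
  functions, and relation 5 is the graph of the function under which the level has to be closed.\<close>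

definition ReflF :: fm where
  "ReflF = Imp (FunF 0) (Conj (FunF 5) (WitF 0 0 5))"

definition EuclF :: fm where
  "EuclF = Imp (Conj (FunF 0) (Conj (FunF 1) (Conj (FunF 2) (Conj (FunF 3) (Conj (FunF 4)
      (Conj (WitF 0 1 3) (WitF 2 1 4))))))) (Conj (FunF 6) (WitF 0 2 6))"

text \<open>\<open>WitF\<close> speaks of second-order variables only, so variables 0 and 1 are
  first equated with the two graphs stored in the predicate.\<close>

definition SepF :: fm where
  "SepF = Imp (Conj (GraphF 3 0) (Conj (GraphF 4 1) (FunF 3))) (Neg (WitF 0 1 3))"

definition KernelF :: fm where
  "KernelF = Conj LimF (Conj (ClosF 3) (Conj (ClosF 4) (Conj (ClosF 5) (Conj ReflF (Conj EuclF SepF)))))"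

text \<open>Witnesses in hypotheses become universal and those in conclusions existential. The
  clauses can share one prefix, which is therefore \<open>\<Pi>\<^sup>1\<^sub>2\<close>.\<close>

definition SentenceF :: fm where
  "SentenceF = Forall2 0 (Forall2 1 (Forall2 2 (Forall2 3 (Forall2 4 (Exists2 5 (Exists2 6 KernelF))))))"

lemmas kernel_defs = FunF_def SegF_def WitF_def GraphF_def ClosF_def LimF_def ReflF_def EuclF_def SepF_def
  KernelF_def

lemma pi1_SentenceF: "pi1 2 SentenceF"
proof -
  have "first_order KernelF" by (simp add: kernel_defs)
  then have "sigma1 (Suc 0) (Exists2 5 (Exists2 6 KernelF))"
    by (intro sigma1_ex sigma1_incl pi1_base)
  then have "pi1 (Suc (Suc 0)) SentenceF"
    unfolding SentenceF_def by (intro pi1_all pi1_incl)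
  then show ?thesis by (simp add: numeral_2_eq_2)
qed

lemma free_kernel [simp]:
  "free1 (FunF A) = {}" "free2 (FunF A) = {A}"
  "free1 (SegF s A) = {0, s} - {4, 5}" "free2 (SegF s A) = {A}"
  "free1 (WitF A B C) = {}" "free2 (WitF A B C) = {A, B, C}"
  "free1 (GraphF n A) = {}" "free2 (GraphF n A) = {A}"
  "free1 (ClosF n) = {}" "free2 (ClosF n) = {}"
  "free1 LimF = {}" "free2 LimF = {}"
  by (auto simp: FunF_def SegF_def WitF_def GraphF_def ClosF_def LimF_def)

lemma sentence_SentenceF: "sentence SentenceF"
  by (auto simp: sentence_def SentenceF_def KernelF_def ReflF_def EuclF_def SepF_def)

context hierarchy
begin

definition gr :: "'v set \<Rightarrow> 'k \<Rightarrow> 'k \<Rightarrow> bool" where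
  "gr A \<beta> \<gamma> \<longleftrightarrow> kpair (ord \<beta>) (ord \<gamma>) \<in> A"

definition graph_set :: "'k set \<Rightarrow> ('k \<Rightarrow> 'k) \<Rightarrow> 'v set" where
  "graph_set I f = {kpair (ord \<beta>) (ord (f \<beta>)) | \<beta>. \<beta> \<in> I}"

lemma agree_graph_set: "agree I (gr (graph_set I f)) f"
  by (auto simp: agree_def gr_def graph_set_def)

end

context level
begin

lemma graph_set_subset: "maps I f \<Longrightarrow> graph_set I f \<subseteq> M"
  using M_closed(3,4) unfolding graph_set_def maps_def by fast

lemma sat_FunF: "sat elts M R (ord \<circ> e) X (FunF A) \<longleftrightarrow> isfun I (gr (X A))"
  by (simp add: FunF_def isfun_def gr_def M_closed(2-4))

lemma sat_WitF: "sat elts M R (ord \<circ> e) X (WitF A B C)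
    \<longleftrightarrow> wit I (Q 1) (Q 2) (gr (X A)) (gr (X B)) (gr (X C))"
  by (simp add: WitF_def SegF_def wit_def seg_def gr_def)

lemma sat_GraphF: "n \<noteq> 0 \<Longrightarrow> sat elts M R (ord \<circ> e) X (GraphF n A)
    \<longleftrightarrow> (\<forall>\<beta>\<in>I. \<forall>\<gamma>\<in>I. Q n \<beta> \<gamma> \<gamma> \<longleftrightarrow> gr (X A) \<beta> \<gamma>)"
  by (simp add: GraphF_def gr_def)

lemma sat_ClosF: "n \<noteq> 0 \<Longrightarrow> sat elts M R (ord \<circ> e) X (ClosF n) \<longleftrightarrow> (\<forall>\<beta>\<in>I. \<exists>\<gamma>\<in>I. Q n \<beta> \<gamma> \<gamma>)"
  by (simp add: ClosF_def)

lemmas sat_kernel_rules = sat_FunF sat_WitF sat_GraphF sat_ClosF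

end

lemma sat_LimF: "sat elts M R e X LimF \<longleftrightarrow> M \<noteq> {} \<and> (\<forall>x\<in>M. \<exists>y\<in>M. x \<in> elts y)"
  by (auto simp: LimF_def)

lemma sat_SentenceF:
  "sat elts M R e X SentenceF \<longleftrightarrow>
     (\<forall>A0\<subseteq>M. \<forall>A1\<subseteq>M. \<forall>A2\<subseteq>M. \<forall>A3\<subseteq>M. \<forall>A4\<subseteq>M. \<exists>A5\<subseteq>M. \<exists>A6\<subseteq>M.
        sat elts M R e (X(0 := A0, 1 := A1, 2 := A2, 3 := A3, 4 := A4, 5 := A5, 6 := A6)) KernelF)"
  by (simp add: SentenceF_def)

context level
begin

lemma sat_KernelF: "sat elts M R (ord \<circ> e) X KernelF \<longleftrightarrow>
    sat elts M R (ord \<circ> e) X LimF \<and>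
    (\<forall>n\<in>{3,4,5}. \<forall>\<beta>\<in>I. \<exists>\<gamma>\<in>I. Q n \<beta> \<gamma> \<gamma>) \<and>
    (isfun I (gr (X 0)) \<longrightarrow> isfun I (gr (X 5)) \<and> wit I (Q 1) (Q 2) (gr (X 0)) (gr (X 0)) (gr (X 5))) \<and>
    ((\<forall>i\<in>{0,1,2,3,4}. isfun I (gr (X i))) \<and>
      wit I (Q 1) (Q 2) (gr (X 0)) (gr (X 1)) (gr (X 3)) \<and> wit I (Q 1) (Q 2) (gr (X 2)) (gr (X 1)) (gr (X 4))
      \<longrightarrow> isfun I (gr (X 6)) \<and> wit I (Q 1) (Q 2) (gr (X 0)) (gr (X 2)) (gr (X 6))) \<and>
    ((\<forall>\<beta>\<in>I. \<forall>\<gamma>\<in>I. Q 3 \<beta> \<gamma> \<gamma> \<longleftrightarrow> gr (X 0) \<beta> \<gamma>) \<and> (\<forall>\<beta>\<in>I. \<forall>\<gamma>\<in>I. Q 4 \<beta> \<gamma> \<gamma> \<longleftrightarrow> gr (X 1) \<beta> \<gamma>)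
      \<and> isfun I (gr (X 3)) \<longrightarrow> \<not> wit I (Q 1) (Q 2) (gr (X 0)) (gr (X 1)) (gr (X 3)))"
  by (simp add: KernelF_def ReflF_def EuclF_def SepF_def sat_kernel_rules)

text \<open>This lemma and the next exchange witnesses that are functions for witnesses that are
  sets in the range of the second-order quantifiers.\<close>

lemma ex_witness:
  assumes "agree I F f" "agree I G g" "sim I D T f g"
  shows "\<exists>A\<subseteq>M. isfun I (gr A) \<and> wit I D T F G (gr A)"
proof -
  obtain h where h: "maps I h" "wit I D T (graph f) (graph g) (graph h)"
    using assms(3) by (auto simp: sim_def)
  have "wit I D T F G (gr (graph_set I h))"
    using h(2) wit_agree[OF assms(1,2) agree_graph_set] by blast
  then show ?thesis
    using graph_set_subset[OF h(1)] agree_graph_set h(1) isfun_iff by blast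
qed

lemma sim_of_witness:
  assumes "agree I F f" "agree I G g" "isfun I H" "wit I D T F G H"
  shows "sim I D T f g"
  using assms wit_agree[OF assms(1,2)] unfolding isfun_iff sim_def by blast

end

section \<open>Reflection of an inequivalent pair\<close>

context hierarchy
begin

text \<open>The free choice of \<zeta> is what later lets \<alpha> be taken in a prescribed
  club.\<close>

lemma reflection:
  fixes D T :: "'k \<Rightarrow> 'k \<Rightarrow> 'k \<Rightarrow> bool" and \<eta> \<xi> \<zeta> :: "'k \<Rightarrow> 'k"
  assumes indescribable: "pi1_indescribable 2 elts V"
    and equiv: "equiv_at UNIV D T" and sep: "\<not> sim UNIV D T \<eta> \<xi>"
  shows "\<exists>\<alpha>. (\<exists>\<beta>. \<beta> < \<alpha>) \<and> (\<forall>\<beta><\<alpha>. \<exists>\<gamma><\<alpha>. \<beta> < \<gamma>) \<and>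
    maps {..<\<alpha>} \<eta> \<and> maps {..<\<alpha>} \<xi> \<and> maps {..<\<alpha>} \<zeta> \<and>
    equiv_at {..<\<alpha>} D T \<and> \<not> sim {..<\<alpha>} D T \<eta> \<xi>"
proof -
  \<comment> \<open>The graphs ignore their third argument, which the formulas fill with a copy of
    the second.\<close>
  define Q :: "nat \<Rightarrow> 'k \<Rightarrow> 'k \<Rightarrow> 'k \<Rightarrow> bool" where
    "Q n = (if n = 1 then D else if n = 2 then T else if n = 3 then (\<lambda>a b c. \<eta> a = b)
       else if n = 4 then (\<lambda>a b c. \<xi> a = b) else (\<lambda>a b c. \<zeta> a = b))" for n
  have Q: "Q (Suc 0) = D" "Q 2 = T" "Q 3 = (\<lambda>a b c. \<eta> a = b)" "Q 4 = (\<lambda>a b c. \<xi> a = b)"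
    "Q 5 = (\<lambda>a b c. \<zeta> a = b)" by (auto simp: Q_def)
  define e :: "nat \<Rightarrow> 'k" where "e = (\<lambda>_. undefined)"
  define X :: "nat \<Rightarrow> 'v set" where "X = (\<lambda>_. {})"
  interpret U: level elts V UNIV UNIV Q "pred_of Q"
    by standard (auto simp: domain_UNIV)
  have "sat elts UNIV (pred_of Q) (ord \<circ> e) X SentenceF"
    unfolding sat_SentenceF
  proof (intro allI impI)
    fix A0 A1 A2 A3 A4 :: "'v set"
    let ?F = "\<lambda>A. isfun UNIV (gr A)" and ?W = "\<lambda>A B C. wit UNIV D T (gr A) (gr B) (gr C)"
    \<comment> \<open>If A0 is not a function, any set will do; otherwise reflexivity supplies the
      witness. A6 is found likewise from the Euclidean property.\<close>
    have "\<exists>A5. ?F A0 \<longrightarrow> ?F A5 \<and> ?W A0 A0 A5"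
    proof (cases "?F A0")
      case True
      then obtain f where f: "maps UNIV f" "agree UNIV (gr A0) f" unfolding isfun_iff by blast
      then have "sim UNIV D T f f" using equiv by (auto simp: equiv_at_def)
      then show ?thesis using U.ex_witness[OF f(2) f(2)] by blast
    qed blast
    then obtain A5 where A5: "?F A0 \<longrightarrow> ?F A5 \<and> ?W A0 A0 A5" by blast
    let ?P = "?F A0 \<and> ?F A1 \<and> ?F A2 \<and> ?F A3 \<and> ?F A4 \<and> ?W A0 A1 A3 \<and> ?W A2 A1 A4"
    have "\<exists>A6. ?P \<longrightarrow> ?F A6 \<and> ?W A0 A2 A6"
    proof (cases ?P)
      case True
      then obtain f g h where f: "maps UNIV f" "agree UNIV (gr A0) f"
        and g: "maps UNIV g" "agree UNIV (gr A1) g" and h: "maps UNIV h" "agree UNIV (gr A2) h"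
        unfolding isfun_iff by blast
      have "sim UNIV D T f g" "sim UNIV D T h g"
        using True U.sim_of_witness f g h by blast+
      then have "sim UNIV D T f h" using equiv f g h unfolding equiv_at_def by blast
      then show ?thesis using U.ex_witness[OF f(2) h(2)] by blast
    qed blast
    then obtain A6 where A6: "?P \<longrightarrow> ?F A6 \<and> ?W A0 A2 A6" by blast
    let ?X = "X(0 := A0, 1 := A1, 2 := A2, 3 := A3, 4 := A4, 5 := A5, 6 := A6)"
    have "\<not> ?W A0 A1 A3" if "\<forall>\<beta> \<gamma>. \<eta> \<beta> = \<gamma> \<longleftrightarrow> gr A0 \<beta> \<gamma>" "\<forall>\<beta> \<gamma>. \<xi> \<beta> = \<gamma> \<longleftrightarrow> gr A1 \<beta> \<gamma>" "?F A3"
    proof -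
      have "agree UNIV (gr A0) \<eta>" "agree UNIV (gr A1) \<xi>" using that by (auto simp: agree_def)
      then show ?thesis using U.sim_of_witness that(3) sep by blast
    qed
    moreover have "sat elts UNIV (pred_of Q) (ord \<circ> e) ?X LimF"
      unfolding sat_LimF by (metis UNIV_I UNIV_not_empty elts_upair insertI1)
    ultimately have "sat elts UNIV (pred_of Q) (ord \<circ> e) ?X KernelF"
      unfolding U.sat_KernelF using A5 A6 by (simp add: Q)
    then show "\<exists>A5\<subseteq>UNIV. \<exists>A6\<subseteq>UNIV. sat elts UNIV (pred_of Q) (ord \<circ> e)
        (X(0 := A0, 1 := A1, 2 := A2, 3 := A3, 4 := A4, 5 := A5, 6 := A6)) KernelF" by blast
  qed
  then have "models elts UNIV (pred_of Q) SentenceF"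
    using models_iff_sat[OF sentence_SentenceF] by blast
  then obtain \<alpha> where "models elts (V \<alpha>) (pred_of Q \<inter> V \<alpha>) SentenceF"
    using indescribable sentence_SentenceF pi1_SentenceF unfolding pi1_indescribable_def by blast
  then have sat: "sat elts (V \<alpha>) (pred_of Q \<inter> V \<alpha>) (ord \<circ> e) X SentenceF"
    by (simp add: models_def)
  \<comment> \<open>Only \<open>LimF\<close> is read off here, from empty sets. The other clauses
    have to wait until \<alpha> is known to be a limit and V \<alpha> to be a
    \<open>domain\<close>.\<close>
  have "\<exists>X. sat elts (V \<alpha>) (pred_of Q \<inter> V \<alpha>) (ord \<circ> e) X KernelF"
    using sat[unfolded sat_SentenceF, rule_format,
        OF empty_subsetI empty_subsetI empty_subsetI empty_subsetI empty_subsetI] by blast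
  then have lim: "V \<alpha> \<noteq> {}" "\<forall>x\<in>V \<alpha>. \<exists>y\<in>V \<alpha>. x \<in> elts y"
    by (auto simp: KernelF_def sat_LimF)
  have pos: "\<exists>\<beta>. \<beta> < \<alpha>" using lim(1) V_iff by blast
  have limit: "\<exists>\<gamma><\<alpha>. \<beta> < \<gamma>" if "\<beta> < \<alpha>" for \<beta>
  proof -
    obtain y where "y \<in> V \<alpha>" "ord \<beta> \<in> elts y" using lim(2) \<open>\<beta> < \<alpha>\<close> ord_in_V by blast
    then obtain \<gamma> where "\<gamma> < \<alpha>" "ord \<beta> \<in> V \<gamma>" using V_iff[of y \<alpha>] by blast
    then show ?thesis by auto
  qed
  let ?I = "{..<\<alpha>}"
  interpret L: level elts V "V \<alpha>" ?I Q "pred_of Q \<inter> V \<alpha>"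
    by standard (use domain_V pos limit in blast, rule refl)
  let ?F = "\<lambda>A. isfun ?I (gr A)" and ?W = "\<lambda>A B C. wit ?I D T (gr A) (gr B) (gr C)"
  have kernel: "\<exists>A5\<subseteq>V \<alpha>. \<exists>A6\<subseteq>V \<alpha>.
    (\<forall>\<beta>\<in>?I. \<eta> \<beta> \<in> ?I) \<and> (\<forall>\<beta>\<in>?I. \<xi> \<beta> \<in> ?I) \<and> (\<forall>\<beta>\<in>?I. \<zeta> \<beta> \<in> ?I) \<and>
    (?F A0 \<longrightarrow> ?F A5 \<and> ?W A0 A0 A5) \<and>
    (?F A0 \<and> ?F A1 \<and> ?F A2 \<and> ?F A3 \<and> ?F A4 \<and> ?W A0 A1 A3 \<and> ?W A2 A1 A4 \<longrightarrow> ?F A6 \<and> ?W A0 A2 A6) \<and>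
    (agree ?I (gr A0) \<eta> \<and> agree ?I (gr A1) \<xi> \<and> ?F A3 \<longrightarrow> \<not> ?W A0 A1 A3)"
    if A: "A0 \<subseteq> V \<alpha>" "A1 \<subseteq> V \<alpha>" "A2 \<subseteq> V \<alpha>" "A3 \<subseteq> V \<alpha>" "A4 \<subseteq> V \<alpha>" for A0 A1 A2 A3 A4
  proof -
    obtain A5 A6 where sub: "A5 \<subseteq> V \<alpha>" "A6 \<subseteq> V \<alpha>" and
      *: "sat elts (V \<alpha>) (pred_of Q \<inter> V \<alpha>) (ord \<circ> e)
        (X(0 := A0, 1 := A1, 2 := A2, 3 := A3, 4 := A4, 5 := A5, 6 := A6)) KernelF"
      using sat[unfolded sat_SentenceF, rule_format, OF A] by blast
    have clos: "(\<forall>\<beta>\<in>?I. \<eta> \<beta> \<in> ?I) \<and> (\<forall>\<beta>\<in>?I. \<xi> \<beta> \<in> ?I) \<and> (\<forall>\<beta>\<in>?I. \<zeta> \<beta> \<in> ?I)"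
      using * unfolding L.sat_KernelF by (simp add: Q)
    have "?F A0 \<longrightarrow> ?F A5 \<and> ?W A0 A0 A5"
      using * unfolding L.sat_KernelF by (simp add: Q)
    moreover have "?F A0 \<and> ?F A1 \<and> ?F A2 \<and> ?F A3 \<and> ?F A4 \<and> ?W A0 A1 A3 \<and> ?W A2 A1 A4 \<longrightarrow> ?F A6 \<and> ?W A0 A2 A6"
      using * unfolding L.sat_KernelF by (simp add: Q)
    moreover have "agree ?I (gr A0) \<eta> \<and> agree ?I (gr A1) \<xi> \<and> ?F A3 \<longrightarrow> \<not> ?W A0 A1 A3"
      using * unfolding L.sat_KernelF agree_def by (simp add: Q)
    ultimately show ?thesis using sub clos by blast
  qed
  let ?g = "graph_set ?I"
  have g: "?g f \<subseteq> V \<alpha>" "agree ?I (gr (?g f)) f" "?F (?g f)" if "maps ?I f" for f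
    using L.graph_set_subset[OF that] agree_graph_set isfun_iff that by blast+
  have W: "?W (?g f) (?g f') (?g h) \<longleftrightarrow> wit ?I D T (graph f) (graph f') (graph h)" for f f' h
    by (rule wit_agree) (rule agree_graph_set)+
  have closed: "maps ?I \<eta>" "maps ?I \<xi>" "maps ?I \<zeta>"
    using kernel[of "{}" "{}" "{}" "{}" "{}"] by (auto simp: maps_def)
  have refl: "sim ?I D T f f" if f: "maps ?I f" for f
  proof -
    obtain A5 where "?F A5" "?W (?g f) (?g f) A5"
      using kernel[OF g(1)[OF f] g(1)[OF f] g(1)[OF f] g(1)[OF f] g(1)[OF f]] g(3)[OF f] by blast
    then show ?thesis using L.sim_of_witness g(2)[OF f] by blast
  qed
  have eucl: "sim ?I D T f f''" if f: "maps ?I f" "maps ?I f'" "maps ?I f''"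
    and sims: "sim ?I D T f f'" "sim ?I D T f'' f'" for f f' f''
  proof -
    obtain h h' where h: "maps ?I h" "maps ?I h'" "wit ?I D T (graph f) (graph f') (graph h)"
      "wit ?I D T (graph f'') (graph f') (graph h')"
      using sims unfolding sim_def by blast
    then obtain A6 where "?F A6" "?W (?g f) (?g f'') A6"
      using kernel[OF g(1)[OF f(1)] g(1)[OF f(2)] g(1)[OF f(3)] g(1)[OF h(1)] g(1)[OF h(2)]] W
        g(3)[OF f(1)] g(3)[OF f(2)] g(3)[OF f(3)] g(3)[OF h(1)] g(3)[OF h(2)] by blast
    then show ?thesis using L.sim_of_witness g(2)[OF f(1)] g(2)[OF f(3)] by blast
  qed
  have "\<not> sim ?I D T \<eta> \<xi>"
  proof
    assume "sim ?I D T \<eta> \<xi>"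
    then obtain h where h: "maps ?I h" "wit ?I D T (graph \<eta>) (graph \<xi>) (graph h)" by (auto simp: sim_def)
    then show False
      using kernel[OF g(1)[OF closed(1)] g(1)[OF closed(2)] _ g(1)[OF h(1)], of "{}" "{}"] W
        g(2)[OF closed(1)] g(2)[OF closed(2)] g(3)[OF h(1)] by blast
  qed
  moreover have "equiv_at ?I D T" using refl eucl unfolding equiv_at_def by blast
  ultimately show ?thesis using pos limit closed by blast
qed

end

section \<open>The bounded topology\<close>

definition restr :: "('k::wellorder \<Rightarrow> 'k) \<Rightarrow> 'k \<Rightarrow> ('k \<rightharpoonup> 'k)" where
  "restr f \<beta> = (\<lambda>\<gamma>. if \<gamma> < \<beta> then Some (f \<gamma>) else None)"

lemma restr_short [simp]: "restr f \<beta> \<in> short_seqs"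
  unfolding short_seqs_def restr_def dom_def by auto

lemma restr_eq_iff: "restr f \<beta> = restr g \<beta> \<longleftrightarrow> (\<forall>\<gamma><\<beta>. f \<gamma> = g \<gamma>)"
  unfolding restr_def fun_eq_iff by auto

lemma basic_open_restr [simp]: "g \<in> basic_open (restr f \<beta>) \<longleftrightarrow> restr g \<beta> = restr f \<beta>"
  unfolding basic_open_def restr_eq_iff by (auto simp: restr_def map_le_def dom_def)

lemma restr_eq_mono: "restr f \<beta> = restr g \<beta> \<Longrightarrow> \<gamma> \<le> \<beta> \<Longrightarrow> restr f \<gamma> = restr g \<gamma>"
  by (meson restr_eq_iff less_le_trans)

lemma short_seq_restr:
  assumes "\<zeta> \<in> short_seqs" "f \<in> basic_open \<zeta>"
  obtains \<beta> where "\<zeta> = restr f \<beta>"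
proof -
  obtain \<beta> where "dom \<zeta> = {..<\<beta>}" using assms(1) by (auto simp: short_seqs_def)
  then have "\<zeta> \<gamma> = restr f \<beta> \<gamma>" for \<gamma>
    using assms(2) by (cases "\<gamma> < \<beta>") (auto simp: basic_open_def map_le_def restr_def)
  then show thesis using that by blast
qed

text \<open>The basic neighbourhoods of f shrink with the length, so the one for the larger of two
  lengths lies in the intersection of the two.\<close>

lemma openin_bounded_iff:
  "openin bounded_topology U \<longleftrightarrow> (\<forall>f\<in>U. \<exists>\<beta>. basic_open (restr f \<beta>) \<subseteq> U)"
proof
  assume "openin bounded_topology U"
  then have "generate_topology_on (basic_open ` short_seqs) U"
    unfolding bounded_topology_def by (rule openin_topology_generated_by)
  then show "\<forall>f\<in>U. \<exists>\<beta>. basic_open (restr f \<beta>) \<subseteq> U"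
  proof induction
    case (Int A B)
    show ?case
    proof
      fix f assume "f \<in> A \<inter> B"
      then obtain \<beta> \<gamma> where *: "basic_open (restr f \<beta>) \<subseteq> A" "basic_open (restr f \<gamma>) \<subseteq> B"
        using Int.IH by blast
      have "basic_open (restr f (max \<beta> \<gamma>)) \<subseteq> A \<inter> B"
      proof
        fix g assume "g \<in> basic_open (restr f (max \<beta> \<gamma>))"
        then have "g \<in> basic_open (restr f \<beta>)" "g \<in> basic_open (restr f \<gamma>)"
          using restr_eq_mono[of g "max \<beta> \<gamma>" f] by simp_all
        then show "g \<in> A \<inter> B" using * by blast
      qed
      then show "\<exists>\<beta>. basic_open (restr f \<beta>) \<subseteq> A \<inter> B" by blast
    qed
  next
    case (UN K)
    then show ?case by (meson UnionE Union_upper subset_trans)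
  next
    case (Basis s)
    then show ?case by (metis imageE order_refl short_seq_restr)
  qed auto
next
  assume *: "\<forall>f\<in>U. \<exists>\<beta>. basic_open (restr f \<beta>) \<subseteq> U"
  have "U = \<Union>{B \<in> basic_open ` short_seqs. B \<subseteq> U}"
  proof
    show "U \<subseteq> \<Union>{B \<in> basic_open ` short_seqs. B \<subseteq> U}"
    proof
      fix f assume "f \<in> U"
      then obtain \<beta> where "basic_open (restr f \<beta>) \<subseteq> U" using * by blast
      moreover have "f \<in> basic_open (restr f \<beta>)" by simp
      ultimately show "f \<in> \<Union>{B \<in> basic_open ` short_seqs. B \<subseteq> U}" using restr_short by blast
    qed
  qed blast
  moreover have "openin bounded_topology (\<Union>{B \<in> basic_open ` short_seqs. B \<subseteq> U})"
    unfolding bounded_topology_def by (intro openin_Union) (auto intro: topology_generated_by_Basis)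
  ultimately show "openin bounded_topology U" by simp
qed

lemma openin_basic_restr: "openin bounded_topology (basic_open (restr f \<beta>))"
  unfolding openin_bounded_iff by (metis basic_open_restr order_refl)

lemma topspace_bounded [simp]: "topspace bounded_topology = UNIV"
proof -
  have "openin bounded_topology UNIV" by (simp add: openin_bounded_iff)
  then show ?thesis using openin_subset by blast
qed

text \<open>Membership in a closed set is decided by initial segments. The sides of a box around a
  triple may be given the same length, the maximum of the three.\<close>

lemma closedin_triple_iff:
  "closedin (prod_topology (prod_topology bounded_topology bounded_topology) bounded_topology) C \<longleftrightarrow>
    (\<forall>f g h. (\<forall>\<beta>. \<exists>f' g' h'. ((f', g'), h') \<in> C \<and>
      restr f' \<beta> = restr f \<beta> \<and> restr g' \<beta> = restr g \<beta> \<and> restr h' \<beta> = restr h \<beta>) \<longrightarrow> ((f, g), h) \<in> C)"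
  (is "closedin ?X C \<longleftrightarrow> ?R")
proof -
  have "closedin ?X C \<longleftrightarrow> openin ?X (- C)"
    by (simp add: closedin_def Compl_eq_Diff_UNIV)
  also have "\<dots> \<longleftrightarrow> ?R"
  proof
    assume op: "openin ?X (- C)"
    show ?R
    proof (intro allI impI, rule ccontr)
      fix f g h
      assume lim: "\<forall>\<beta>. \<exists>f' g' h'. ((f', g'), h') \<in> C \<and>
          restr f' \<beta> = restr f \<beta> \<and> restr g' \<beta> = restr g \<beta> \<and> restr h' \<beta> = restr h \<beta>"
        and "((f, g), h) \<notin> C"
      then have "((f, g), h) \<in> - C" by simp
      then obtain P W where P: "openin (prod_topology bounded_topology bounded_topology) P"
        and W: "openin bounded_topology W" and in_P: "(f, g) \<in> P" and "h \<in> W" and PW: "P \<times> W \<subseteq> - C"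
        using op[unfolded openin_prod_topology_alt[of _ _ "- C"], rule_format, of "(f, g)" h] by blast
      obtain U U' where U: "openin bounded_topology U" and U': "openin bounded_topology U'"
        and "f \<in> U" "g \<in> U'" and "U \<times> U' \<subseteq> P"
        using P[unfolded openin_prod_topology_alt[of _ _ P], rule_format, OF in_P] by blast
      then have sub: "(U \<times> U') \<times> W \<subseteq> - C" using PW by blast
      obtain a where a: "basic_open (restr f a) \<subseteq> U" using U \<open>f \<in> U\<close> unfolding openin_bounded_iff by blast
      obtain b where b: "basic_open (restr g b) \<subseteq> U'" using U' \<open>g \<in> U'\<close> unfolding openin_bounded_iff by blast
      obtain c where c: "basic_open (restr h c) \<subseteq> W" using W \<open>h \<in> W\<close> unfolding openin_bounded_iff by blast
      define d where "d = max a (max b c)"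
      have d: "a \<le> d" "b \<le> d" "c \<le> d" by (auto simp: d_def le_max_iff_disj)
      obtain f' g' h' where in_C: "((f', g'), h') \<in> C" and
        eq: "restr f' d = restr f d" "restr g' d = restr g d" "restr h' d = restr h d"
        using lim[THEN spec[of _ d]] by blast
      then have "f' \<in> U" "g' \<in> U'" "h' \<in> W"
        using a b c restr_eq_mono[OF eq(1) d(1)] restr_eq_mono[OF eq(2) d(2)] restr_eq_mono[OF eq(3) d(3)]
        by auto
      then show False using sub in_C by blast
    qed
  next
    assume R: ?R
    show "openin ?X (- C)"
      unfolding openin_prod_topology_alt[of _ _ "- C"]
    proof (intro allI impI)
      fix p :: "('a \<Rightarrow> 'a) \<times> ('a \<Rightarrow> 'a)" and h :: "'a \<Rightarrow> 'a"
      assume ph: "(p, h) \<in> - C"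
      obtain f g where p: "p = (f, g)" by (cases p)
      have "((f, g), h) \<notin> C" using ph p by simp
      then obtain \<beta> where "\<not> (\<exists>f' g' h'. ((f', g'), h') \<in> C \<and>
          restr f' \<beta> = restr f \<beta> \<and> restr g' \<beta> = restr g \<beta> \<and> restr h' \<beta> = restr h \<beta>)"
        using R[THEN spec[of _ f], THEN spec[of _ g], THEN spec[of _ h]] by meson
      then have \<beta>: "((f', g'), h') \<notin> C" if "restr f' \<beta> = restr f \<beta>" "restr g' \<beta> = restr g \<beta>"
        "restr h' \<beta> = restr h \<beta>" for f' g' h' using that by meson
      let ?P = "basic_open (restr f \<beta>) \<times> basic_open (restr g \<beta>)"
      have "openin (prod_topology bounded_topology bounded_topology) ?P"
        by (simp add: openin_prod_Times_iff openin_basic_restr)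
      moreover have "?P \<times> basic_open (restr h \<beta>) \<subseteq> - C" using \<beta> by auto
      moreover have "p \<in> ?P" "h \<in> basic_open (restr h \<beta>)" using p by auto
      ultimately show "\<exists>U W. openin (prod_topology bounded_topology bounded_topology) U \<and>
          openin bounded_topology W \<and> p \<in> U \<and> h \<in> W \<and> U \<times> W \<subseteq> - C"
        using openin_basic_restr by blast
    qed
  qed
  finally show ?thesis .
qed

text \<open>There are only \<kappa> many basic sets. As the union runs over all of
  \<open>'k\<close>, indices of basic sets outside U are redirected to a fixed basic subset of U.
  The empty set has no such subset and is obtained as an intersection of two disjoint basic
  sets.\<close>

lemma open_kappa_borel:
  fixes U :: "('k::wellorder \<Rightarrow> 'k) set"
  assumes card: "(short_seqs :: ('k \<rightharpoonup> 'k) set) \<approx> (UNIV :: 'k set)"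
    and two: "\<exists>\<beta>::'k. \<beta> < \<alpha>" and op: "openin bounded_topology U"
  shows "U \<in> kappa_borel"
proof (cases "U = {}")
  case True
  obtain \<beta> where \<beta>: "\<beta> < \<alpha>" using two by blast
  let ?A = "\<lambda>\<gamma>. if \<gamma> = \<alpha> then basic_open (restr (\<lambda>_. \<alpha>) \<alpha>) else basic_open (restr (\<lambda>_. \<beta>) \<alpha>)"
  have "(\<Inter>\<gamma>. ?A \<gamma>) \<in> kappa_borel"
    by (rule kappa_borel.inter) (simp add: kappa_borel.basic)
  moreover have "(\<Inter>\<gamma>. ?A \<gamma>) = {}"
  proof -
    have "f \<notin> ?A \<alpha> \<inter> ?A \<beta>" for f using \<beta> by (auto simp: restr_eq_iff)
    then show ?thesis by blast
  qed
  ultimately show ?thesis using True by simp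
next
  case False
  then obtain f0 where "f0 \<in> U" by blast
  then obtain \<beta>0 where \<beta>0: "basic_open (restr f0 \<beta>0) \<subseteq> U" using op openin_bounded_iff by blast
  obtain c :: "'k \<Rightarrow> ('k \<rightharpoonup> 'k)" where c: "bij_betw c UNIV short_seqs"
    using card eqpoll_sym eqpoll_def by blast
  let ?A = "\<lambda>\<gamma>. if basic_open (c \<gamma>) \<subseteq> U then basic_open (c \<gamma>) else basic_open (restr f0 \<beta>0)"
  have "(\<Union>\<gamma>. ?A \<gamma>) \<in> kappa_borel"
    using c by (intro kappa_borel.union) (auto simp: bij_betw_def intro!: kappa_borel.basic)
  moreover have "(\<Union>\<gamma>. ?A \<gamma>) = U"
  proof
    show "(\<Union>\<gamma>. ?A \<gamma>) \<subseteq> U" using \<beta>0 by (auto split: if_splits)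
    show "U \<subseteq> (\<Union>\<gamma>. ?A \<gamma>)"
    proof
      fix f assume "f \<in> U"
      then obtain \<beta> where \<beta>: "basic_open (restr f \<beta>) \<subseteq> U" using op openin_bounded_iff by blast
      obtain \<gamma> where "c \<gamma> = restr f \<beta>" using c restr_short unfolding bij_betw_def by (metis imageE)
      then have "f \<in> ?A \<gamma>" using \<beta> by simp
      then show "f \<in> (\<Union>\<gamma>. ?A \<gamma>)" by blast
    qed
  qed
  ultimately show ?thesis by simp
qed

text \<open>The restriction of F f to \<beta> is determined by that of f, so F is
  continuous.\<close>

lemma borel_function_if_local:
  fixes F :: "('k::wellorder \<Rightarrow> 'k) \<Rightarrow> 'k \<Rightarrow> 'k"
  assumes card: "(short_seqs :: ('k \<rightharpoonup> 'k) set) \<approx> (UNIV :: 'k set)" and two: "\<exists>\<beta>::'k. \<beta> < \<alpha>"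
    and loc: "\<And>f g \<alpha>. restr f \<alpha> = restr g \<alpha> \<Longrightarrow> F f \<alpha> = F g \<alpha>"
  shows "borel_function F"
  unfolding borel_function_def
proof (intro allI impI, rule open_kappa_borel[OF card two])
  fix U :: "('k \<Rightarrow> 'k) set" assume U: "openin bounded_topology U"
  show "openin bounded_topology (F -` U)"
    unfolding openin_bounded_iff
  proof
    fix f assume "f \<in> F -` U"
    then have "F f \<in> U" by simp
    then obtain \<beta> where \<beta>: "basic_open (restr (F f) \<beta>) \<subseteq> U"
      using U[unfolded openin_bounded_iff] by blast
    have "F g \<in> U" if g: "restr g \<beta> = restr f \<beta>" for g
    proof -
      have "F g \<gamma> = F f \<gamma>" if "\<gamma> < \<beta>" for \<gamma>
        using loc[OF restr_eq_mono[OF g]] that by simp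
      then have "restr (F g) \<beta> = restr (F f) \<beta>" by (simp add: restr_eq_iff)
      then show ?thesis using \<beta> by auto
    qed
    then have "basic_open (restr f \<beta>) \<subseteq> F -` U" by auto
    then show "\<exists>\<beta>. basic_open (restr f \<beta>) \<subseteq> F -` U" by blast
  qed
qed

section \<open>Regularity from codes\<close>

lemma Field_segment_order: "Field (segment_order \<alpha>) = {..<\<alpha>}"
  by (auto simp: segment_order_def Field_def)

lemma Well_order_segment_order:
  assumes "Well_order {(x::'k::wellorder, y). x \<le> y}"
  shows "Well_order (segment_order (\<alpha>::'k))"
proof -
  have "segment_order \<alpha> = Restr {(x, y). x \<le> y} {..<\<alpha>}" by (auto simp: segment_order_def)
  then show ?thesis using Well_order_Restr[OF assms] by simp
qed

text \<open>A cardinal below the order type \<alpha> is isomorphic to a proper initial segment of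
  \<alpha>.\<close>

lemma small_subset_image:
  includes cardinal_syntax
  fixes \<alpha> :: "'k::wellorder"
  assumes wo: "Well_order {(x::'k, y). x \<le> y}" and K: "|K| <o segment_order \<alpha>" and ne: "K \<noteq> {}"
  obtains a p where "a < \<alpha>" "K = p ` {..<a}"
proof -
  note F = Field_segment_order[of \<alpha>] and W = Well_order_segment_order[OF wo, of \<alpha>]
  obtain a where a: "a < \<alpha>" "|K| =o Restr (segment_order \<alpha>) (underS (segment_order \<alpha>) a)"
    using K ordLess_iff_ordIso_Restr[OF W card_of_Well_order] F by auto
  have "Field (Restr (segment_order \<alpha>) (underS (segment_order \<alpha>) a)) = {..<a}"
    using a(1) by (auto simp: segment_order_def underS_def Field_def)
  then have "|K| =o |{..<a}|" using card_of_cong[OF a(2)] by (simp add: Field_card_of)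
  then obtain p where "bij_betw p {..<a} K"
    using card_of_ordIso ordIso_symmetric by blast
  then show thesis using that a(1) by (auto simp: bij_betw_def)
qed

text \<open>Read D s \<gamma> \<delta> as: the code s has value \<delta> at \<gamma>. The assumption
  \<open>codes\<close> is a form of \<open>\<alpha>\<^sup><\<^sup>\<alpha> \<le> \<alpha>\<close>,
  which forces \<alpha> to be a regular cardinal.\<close>

locale coded =
  fixes \<alpha> :: "'k::wellorder" and D :: "'k \<Rightarrow> 'k \<Rightarrow> 'k \<Rightarrow> bool"
  assumes pos: "\<exists>\<beta>. \<beta> < \<alpha>" and limit: "\<And>\<beta>. \<beta> < \<alpha> \<Longrightarrow> \<exists>\<gamma><\<alpha>. \<beta> < \<gamma>"
    and functional: "\<And>s \<gamma> \<delta> \<delta>'. D s \<gamma> \<delta> \<Longrightarrow> D s \<gamma> \<delta>' \<Longrightarrow> \<delta> = \<delta>'"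
    and codes: "\<And>f \<beta>. (\<forall>\<gamma><\<alpha>. f \<gamma> < \<alpha>) \<Longrightarrow> \<beta> < \<alpha> \<Longrightarrow> \<exists>s<\<alpha>. \<forall>\<gamma><\<beta>. D s \<gamma> (f \<gamma>)"
begin

text \<open>The diagonal argument from Koenig's theorem: a function that differs at \<open>\<gamma>\<close> from all sequences with
  code in \<open>P \<gamma>\<close> has its own code outside every \<open>P \<gamma>\<close>.\<close>

lemma diagonal:
  assumes "a < \<alpha>" and avoid: "\<And>\<gamma>. \<gamma> < a \<Longrightarrow> \<exists>\<delta><\<alpha>. \<forall>s\<in>P \<gamma>. \<not> D s \<gamma> \<delta>"
  shows "\<exists>s<\<alpha>. \<forall>\<gamma><a. s \<notin> P \<gamma>"
proof -
  obtain h where h: "\<And>\<gamma>. \<gamma> < a \<Longrightarrow> h \<gamma> < \<alpha> \<and> (\<forall>s\<in>P \<gamma>. \<not> D s \<gamma> (h \<gamma>))"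
    using avoid by metis
  obtain z where "z < \<alpha>" using pos by blast
  then have "\<forall>\<gamma><\<alpha>. (if \<gamma> < a then h \<gamma> else z) < \<alpha>" using h by auto
  from codes[OF this \<open>a < \<alpha>\<close>]
  obtain s where s: "s < \<alpha>" "\<forall>\<gamma><a. D s \<gamma> (if \<gamma> < a then h \<gamma> else z)"
    by blast
  have "s \<notin> P \<gamma>" if "\<gamma> < a" for \<gamma>
    using h[OF that] s(2)[rule_format, OF that] that by auto
  then show ?thesis using s(1) by blast
qed

text \<open>With P \<gamma> = {p \<gamma>}, one of two distinct values is always avoided at
  \<gamma>, so some code is missed by p.\<close>

lemma not_surj:
  assumes "a < \<alpha>" shows "\<not> {..<\<alpha>} \<subseteq> p ` {..<a}"
proof -
  obtain z where z: "z < \<alpha>" using pos by blast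
  then obtain z' where z': "z' < \<alpha>" "z < z'" using limit by blast
  have "\<exists>\<delta><\<alpha>. \<forall>s\<in>{p \<gamma>}. \<not> D s \<gamma> \<delta>" for \<gamma>
    using functional z z' by (metis order_less_irrefl singletonD)
  from diagonal[OF assms this] show ?thesis by auto
qed

text \<open>With P \<gamma> the codes up to F \<gamma>, the diagonal code is itself the bound.
  Avoidance is possible: if those codes took all values below \<alpha> at \<gamma>, a proper initial
  segment would map onto \<alpha>, against \<open>not_surj\<close>.\<close>

lemma bounded:
  assumes "a < \<alpha>" "\<And>\<gamma>. \<gamma> < a \<Longrightarrow> F \<gamma> < \<alpha>"
  shows "\<exists>\<delta><\<alpha>. \<forall>\<gamma><a. F \<gamma> < \<delta>"
proof -
  have "\<exists>\<delta><\<alpha>. \<forall>s\<in>{..F \<gamma>}. \<not> D s \<gamma> \<delta>" if "\<gamma> < a" for \<gamma>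
  proof (rule ccontr)
    assume "\<not> ?thesis"
    then have *: "\<forall>\<delta><\<alpha>. \<exists>s\<le>F \<gamma>. D s \<gamma> \<delta>" by auto
    obtain c where c: "c < \<alpha>" "F \<gamma> < c" using limit assms(2) \<open>\<gamma> < a\<close> by blast
    have "{..<\<alpha>} \<subseteq> (\<lambda>s. THE \<delta>. D s \<gamma> \<delta>) ` {..<c}"
    proof
      fix \<delta> assume "\<delta> \<in> {..<\<alpha>}"
      then obtain s where "s \<le> F \<gamma>" "D s \<gamma> \<delta>" using * by blast
      moreover from this have "(THE \<delta>. D s \<gamma> \<delta>) = \<delta>" using functional by blast
      ultimately show "\<delta> \<in> (\<lambda>s. THE \<delta>. D s \<gamma> \<delta>) ` {..<c}"
        using c(2) by (metis imageI lessThan_iff order_le_less_trans)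
    qed
    then show False using not_surj[OF c(1)] by blast
  qed
  from diagonal[OF assms(1) this] show ?thesis by (auto simp: not_le)
qed

text \<open>Here \<open>not_surj\<close> makes \<alpha> a cardinal, \<open>limit\<close> makes it
  infinite, and \<open>bounded\<close> rules out cofinal subsets of smaller cardinality.\<close>

lemma in_reg:
  includes cardinal_syntax
  assumes "Well_order {(x::'k, y). x \<le> y}"
  shows "\<alpha> \<in> reg"
proof -
  let ?r = "segment_order \<alpha>"
  note F = Field_segment_order[of \<alpha>] and W = Well_order_segment_order[OF assms, of \<alpha>]
  have le: "|{..<\<alpha>}| \<le>o ?r" using card_of_least[of _ ?r] W F by simp
  have "\<not> |{..<\<alpha>}| <o ?r"
    using small_subset_image[OF assms] not_surj pos by (metis lessThan_iff empty_iff order_refl)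
  then have eq: "|{..<\<alpha>}| =o ?r" using le ordLeq_iff_ordLess_or_ordIso by blast
  then have card: "Card_order ?r" using Card_order_iff_ordIso_card_of F ordIso_symmetric by metis
  have inf: "infinite {..<\<alpha>}"
  proof
    assume fin: "finite {..<\<alpha>}"
    have "{..<\<alpha>} \<noteq> {}" using pos by blast
    then have "Max {..<\<alpha>} < \<alpha>" using Max_in[OF fin] by simp
    then obtain \<gamma> where "\<gamma> < \<alpha>" "Max {..<\<alpha>} < \<gamma>" using limit by blast
    then show False using Max_ge[OF fin] by (simp add: leD)
  qed
  have "|K| =o ?r" if K: "K \<subseteq> {..<\<alpha>}" "cofinal K ?r" for K
  proof (rule ccontr)
    assume "\<not> |K| =o ?r"
    moreover have "|K| \<le>o ?r" using card_of_mono1[OF K(1)] eq ordLeq_ordIso_trans by blast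
    ultimately have "|K| <o ?r" using ordLeq_iff_ordLess_or_ordIso by blast
    have cof: "\<exists>k\<in>K. \<beta> < k" if \<beta>: "\<beta> < \<alpha>" for \<beta>
    proof -
      obtain k where "k \<in> K" "\<beta> \<noteq> k" "(\<beta>, k) \<in> ?r" using K(2) F \<beta> unfolding cofinal_def by auto
      then have "\<beta> < k" by (auto simp: segment_order_def)
      then show ?thesis using \<open>k \<in> K\<close> by blast
    qed
    then have "K \<noteq> {}" using pos by blast
    then obtain a p where a: "a < \<alpha>" "K = p ` {..<a}" using small_subset_image[OF assms \<open>|K| <o ?r\<close>] by blast
    then obtain \<delta> where "\<delta> < \<alpha>" "\<forall>\<gamma><a. p \<gamma> < \<delta>" using bounded[of a p] K(1) by auto
    then show False using cof a(2) by (metis imageE lessThan_iff order_less_asym)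
  qed
  then show ?thesis using card inf F by (simp add: reg_def regularCard_def)
qed

end

section \<open>The reduction to \<open>E_reg\<close>\<close>

lemma maps_lessThan: "maps {..<\<alpha>} f \<longleftrightarrow> (\<forall>\<beta><\<alpha>. f \<beta> < \<alpha>)"
  by (auto simp: maps_def)

lemma sim_cong:
  assumes "\<And>\<gamma>. \<gamma> \<in> I \<Longrightarrow> f \<gamma> = f' \<gamma>" "\<And>\<gamma>. \<gamma> \<in> I \<Longrightarrow> g \<gamma> = g' \<gamma>"
  shows "sim I D T f g \<longleftrightarrow> sim I D T f' g'"
proof -
  have "seg I D s \<beta> (graph f) \<longleftrightarrow> seg I D s \<beta> (graph f')" "seg I D s \<beta> (graph g) \<longleftrightarrow> seg I D s \<beta> (graph g')"
    for s \<beta> using assms by (auto simp: seg_def)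
  then show ?thesis by (simp add: sim_def wit_def)
qed

text \<open>The Euclidean property applied to g \<sim> g and f \<sim> g.\<close>

lemma equiv_at_sym:
  assumes "equiv_at I D T" "maps I f" "maps I g" "sim I D T f g" shows "sim I D T g f"
  using assms unfolding equiv_at_def by metis

lemma equiv_at_trans:
  assumes "equiv_at I D T" "maps I f" "maps I g" "maps I h" "sim I D T f g" "sim I D T g h"
  shows "sim I D T f h"
  using assms equiv_at_sym[OF assms(1,3,4,6)] unfolding equiv_at_def by metis

locale indescribable = hierarchy elts V
  for elts :: "'v \<Rightarrow> 'v set" and V :: "'k::wellorder \<Rightarrow> 'v set" +
  fixes seq :: "'k \<Rightarrow> ('k \<rightharpoonup> 'k)"
  assumes pi12: "pi1_indescribable 2 elts V"
    and seq: "bij_betw seq UNIV short_seqs"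
    and wo: "Well_order {(x::'k, y). x \<le> y}"
begin

definition num_of :: "('k \<Rightarrow> 'k) \<Rightarrow> 'k \<Rightarrow> 'k" where
  "num_of f \<beta> = inv seq (restr f \<beta>)"

definition val :: "'k \<Rightarrow> 'k \<Rightarrow> 'k \<Rightarrow> bool" where
  "val s \<gamma> \<delta> \<longleftrightarrow> seq s \<gamma> = Some \<delta>"

lemma seq_num_of [simp]: "seq (num_of f \<beta>) = restr f \<beta>"
  unfolding num_of_def using seq restr_short by (metis bij_betw_def f_inv_into_f)

lemma seq_inject: "seq s = seq t \<longleftrightarrow> s = t"
  using seq unfolding bij_betw_def by (meson UNIV_I inj_onD)

lemma num_of_eq_iff: "num_of f \<beta> = num_of g \<gamma> \<longleftrightarrow> restr f \<beta> = restr g \<gamma>"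
  by (metis seq_num_of seq_inject)

lemma seg_num_of: "seg I val (num_of f \<beta>) \<beta> (graph f)"
  by (auto simp: seg_def val_def restr_def)

text \<open>Over all of \<kappa> every value is visible, so the code is unique, whereas from below
  \<alpha> different codes may look alike.\<close>

lemma seg_UNIV: "seg UNIV val s \<beta> (graph f) \<longleftrightarrow> s = num_of f \<beta>"
proof
  assume s: "seg UNIV val s \<beta> (graph f)"
  have *: "seq s \<gamma> = Some \<delta> \<longleftrightarrow> \<gamma> < \<beta> \<and> f \<gamma> = \<delta>" for \<gamma> \<delta>
    using s by (simp add: seg_def val_def)
  have "seq s \<gamma> = restr f \<beta> \<gamma>" for \<gamma>
    using * unfolding restr_def by (metis option.exhaust)
  then have "seq s = seq (num_of f \<beta>)" by auto
  then show "s = num_of f \<beta>" using seq_inject by blast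
qed (simp add: seg_num_of)

lemma sim_UNIV: "sim UNIV val T f g \<longleftrightarrow> (\<exists>h. \<forall>\<beta>. T (num_of f \<beta>) (num_of g \<beta>) (num_of h \<beta>))"
  by (simp add: sim_def wit_def seg_UNIV maps_def)

text \<open>Reflexivity alone provides codes below \<open>\<alpha>\<close> for all restrictions of functions on \<open>\<alpha>\<close>.\<close>

lemma reg_if_equiv_at:
  assumes "\<exists>\<beta>. \<beta> < \<alpha>" "\<And>\<beta>. \<beta> < \<alpha> \<Longrightarrow> \<exists>\<gamma><\<alpha>. \<beta> < \<gamma>" and equiv: "equiv_at {..<\<alpha>} val T"
  shows "\<alpha> \<in> reg"
proof -
  interpret coded \<alpha> val
  proof
    fix f :: "'k \<Rightarrow> 'k" and \<beta> assume f: "\<forall>\<gamma><\<alpha>. f \<gamma> < \<alpha>" and \<beta>: "\<beta> < \<alpha>"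
    then have "sim {..<\<alpha>} val T f f" using equiv by (simp add: equiv_at_def maps_lessThan)
    then obtain s where s: "s < \<alpha>" "seg {..<\<alpha>} val s \<beta> (graph f)"
      using \<beta> unfolding sim_def wit_def by blast
    have "val s \<gamma> (f \<gamma>)" if "\<gamma> < \<beta>" for \<gamma>
    proof -
      have "\<gamma> < \<alpha>" using that \<beta> by simp
      then show ?thesis using s(2) f that by (simp add: seg_def)
    qed
    then show "\<exists>s<\<alpha>. \<forall>\<gamma><\<beta>. val s \<gamma> (f \<gamma>)" using s(1) by blast
  qed (use assms in \<open>auto simp: val_def\<close>)
  show ?thesis using in_reg wo .
qed

lemma reflect_reg:
  assumes equiv: "equiv_at UNIV val T" and sep: "\<not> sim UNIV val T \<eta> \<xi>"
  obtains \<alpha> where "\<alpha> \<in> reg" "\<exists>\<beta>. \<beta> < \<alpha>" "maps {..<\<alpha>} \<zeta>" "maps {..<\<alpha>} \<eta>" "maps {..<\<alpha>} \<xi>"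
    "equiv_at {..<\<alpha>} val T" "\<not> sim {..<\<alpha>} val T \<eta> \<xi>"
proof -
  obtain \<alpha> where "\<exists>\<beta>. \<beta> < \<alpha>" "\<forall>\<beta><\<alpha>. \<exists>\<gamma><\<alpha>. \<beta> < \<gamma>"
    "maps {..<\<alpha>} \<eta>" "maps {..<\<alpha>} \<xi>" "maps {..<\<alpha>} \<zeta>"
    "equiv_at {..<\<alpha>} val T" "\<not> sim {..<\<alpha>} val T \<eta> \<xi>"
    using reflection[OF pi12 equiv sep, of \<zeta>] by blast
  moreover from this have "\<alpha> \<in> reg" by (intro reg_if_equiv_at) auto
  ultimately show thesis using that by blast
qed

text \<open>Reflection needs two inequivalent functions; here the equivalence relation is equality, whose tree is
  \<open>s = t\<close>.\<close>

lemma ex_closed_ordinal: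
  fixes \<zeta> :: "'k \<Rightarrow> 'k"
  shows "\<exists>\<alpha>. (\<exists>\<beta>. \<beta> < \<alpha>) \<and> maps {..<\<alpha>} \<zeta>"
proof -
  let ?T = "\<lambda>s t u. s = t"
  have sim: "sim UNIV val ?T f g \<longleftrightarrow> f = g" for f g
  proof -
    have "f \<gamma> = g \<gamma>" if eq: "\<forall>\<beta>. restr f \<beta> = restr g \<beta>" for \<gamma>
    proof -
      obtain \<beta> where "\<gamma> < \<beta>" using no_max by blast
      then show ?thesis using eq by (metis restr_eq_iff)
    qed
    then show ?thesis by (auto simp: sim_UNIV num_of_eq_iff)
  qed
  obtain a b :: 'k where "a < b" using no_max by blast
  then have "\<not> sim UNIV val ?T (\<lambda>_. a) (\<lambda>_. b)" unfolding sim by (metis order_less_irrefl)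
  moreover have "equiv_at UNIV val ?T" by (simp add: equiv_at_def sim)
  ultimately show ?thesis using reflect_reg[of ?T "\<lambda>_. a" "\<lambda>_. b" \<zeta>] by blast
qed

text \<open>Unboundedness is taken from reflection, through \<open>ex_closed_ordinal\<close>,
  instead of iterating \<zeta> and using the regularity of \<kappa>.\<close>

lemma club_closed:
  fixes \<zeta> :: "'k \<Rightarrow> 'k"
  shows "club {\<alpha>. maps {..<\<alpha>} \<zeta>}"
  unfolding club_def
proof
  show "closed_in_ordinal {\<alpha>. maps {..<\<alpha>} \<zeta>}"
    unfolding closed_in_ordinal_def
  proof (intro allI impI, elim conjE)
    fix \<alpha> assume lim: "\<forall>\<beta><\<alpha>. \<exists>\<gamma>\<in>{\<alpha>. maps {..<\<alpha>} \<zeta>}. \<beta> < \<gamma> \<and> \<gamma> < \<alpha>"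
    have "\<zeta> \<beta> < \<alpha>" if "\<beta> < \<alpha>" for \<beta>
      using lim[rule_format, OF that] by (auto simp: maps_lessThan)
    then show "\<alpha> \<in> {\<alpha>. maps {..<\<alpha>} \<zeta>}" by (simp add: maps_lessThan)
  qed
  show "unbounded {\<alpha>. maps {..<\<alpha>} \<zeta>}"
    unfolding unbounded_def
  proof
    fix \<alpha>0
    \<comment> \<open>As \<alpha> is nonzero, closure under the maximum with \<alpha>0 forces
      \<alpha>0 < \<alpha>.\<close>
    obtain \<alpha> where \<alpha>: "\<exists>\<beta>. \<beta> < \<alpha>" "maps {..<\<alpha>} (\<lambda>\<beta>. max (\<zeta> \<beta>) \<alpha>0)"
      using ex_closed_ordinal by blast
    then have "maps {..<\<alpha>} \<zeta>" "\<alpha>0 < \<alpha>" by (auto simp: maps_lessThan)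
    then show "\<exists>\<beta>\<in>{\<alpha>. maps {..<\<alpha>} \<zeta>}. \<alpha>0 \<le> \<beta>" by auto
  qed
qed

text \<open>The function \<open>\<zeta>\<close> stands for the club of ordinals closed under it. Unlike being a club, this makes the
  condition on \<open>\<zeta>\<close> closed in the bounded topology.\<close>

lemma E_reg_iff:
  fixes \<eta> \<xi> :: "'k \<Rightarrow> 'k"
  shows "(\<eta>, \<xi>) \<in> E_reg \<longleftrightarrow> (\<exists>\<zeta>. \<forall>\<alpha>\<in>reg. maps {..<\<alpha>} \<zeta> \<longrightarrow> \<eta> \<alpha> = \<xi> \<alpha>)"
proof
  assume "(\<eta>, \<xi>) \<in> E_reg"
  then obtain C where C: "club C" "{\<alpha>. \<eta> \<alpha> \<noteq> \<xi> \<alpha>} \<inter> reg \<inter> C = {}"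
    by (auto simp: E_reg_def stationary_def)
  have "\<exists>\<gamma>\<in>C. \<beta> < \<gamma>" for \<beta>
    using no_max[of \<beta>] C(1) unfolding club_def unbounded_def by (meson less_le_trans)
  \<comment> \<open>A nonzero ordinal closed under this \<zeta> is a limit of elements of C, hence
    in C.\<close>
  then obtain \<zeta> where \<zeta>: "\<And>\<beta>. \<zeta> \<beta> \<in> C \<and> \<beta> < \<zeta> \<beta>" by metis
  have "\<eta> \<alpha> = \<xi> \<alpha>" if "\<alpha> \<in> reg" "maps {..<\<alpha>} \<zeta>" for \<alpha>
  proof -
    have "infinite {..<\<alpha>}" using that(1) by (simp add: reg_def)
    then have "{..<\<alpha>} \<noteq> {}" by (metis finite.emptyI)
    then have "\<exists>\<beta>. \<beta> < \<alpha>" by blast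
    moreover have "\<forall>\<beta><\<alpha>. \<exists>\<gamma>\<in>C. \<beta> < \<gamma> \<and> \<gamma> < \<alpha>" using that(2) \<zeta> unfolding maps_lessThan by blast
    ultimately have "\<alpha> \<in> C" using C(1) unfolding club_def closed_in_ordinal_def by blast
    then show ?thesis using C(2) that(1) by blast
  qed
  then show "\<exists>\<zeta>. \<forall>\<alpha>\<in>reg. maps {..<\<alpha>} \<zeta> \<longrightarrow> \<eta> \<alpha> = \<xi> \<alpha>" by blast
next
  assume "\<exists>\<zeta>. \<forall>\<alpha>\<in>reg. maps {..<\<alpha>} \<zeta> \<longrightarrow> \<eta> \<alpha> = \<xi> \<alpha>"
  then obtain \<zeta> where "\<forall>\<alpha>\<in>reg. maps {..<\<alpha>} \<zeta> \<longrightarrow> \<eta> \<alpha> = \<xi> \<alpha>" ..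
  then have "{\<alpha>. \<eta> \<alpha> \<noteq> \<xi> \<alpha>} \<inter> reg \<inter> {\<alpha>. maps {..<\<alpha>} \<zeta>} = {}" by blast
  then show "(\<eta>, \<xi>) \<in> E_reg"
    using club_closed[of \<zeta>] unfolding E_reg_def stationary_def by blast
qed

section \<open>\<open>E_reg\<close> as a \<open>\<Sigma>\<^sup>1\<^sub>1\<close> equivalence
  relation\<close>

lemma equiv_E_reg: "equiv UNIV (E_reg :: (('k \<Rightarrow> 'k) \<times> ('k \<Rightarrow> 'k)) set)"
proof (rule equivI)
  show "refl (E_reg :: (('k \<Rightarrow> 'k) \<times> ('k \<Rightarrow> 'k)) set)" by (auto simp: refl_on_def E_reg_iff)
  show "sym (E_reg :: (('k \<Rightarrow> 'k) \<times> ('k \<Rightarrow> 'k)) set)" unfolding sym_def E_reg_iff by metis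
  show "trans (E_reg :: (('k \<Rightarrow> 'k) \<times> ('k \<Rightarrow> 'k)) set)"
  proof (rule transI)
    fix \<eta> \<xi> \<theta> :: "'k \<Rightarrow> 'k" assume "(\<eta>, \<xi>) \<in> E_reg" "(\<xi>, \<theta>) \<in> E_reg"
    then obtain \<zeta> \<zeta>' where *: "\<forall>\<alpha>\<in>reg. maps {..<\<alpha>} \<zeta> \<longrightarrow> \<eta> \<alpha> = \<xi> \<alpha>"
      "\<forall>\<alpha>\<in>reg. maps {..<\<alpha>} \<zeta>' \<longrightarrow> \<xi> \<alpha> = \<theta> \<alpha>" unfolding E_reg_iff by blast
    have "\<eta> \<alpha> = \<theta> \<alpha>" if \<alpha>: "\<alpha> \<in> reg" "maps {..<\<alpha>} (\<lambda>\<beta>. max (\<zeta> \<beta>) (\<zeta>' \<beta>))" for \<alpha>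
    proof -
      have "maps {..<\<alpha>} \<zeta>" "maps {..<\<alpha>} \<zeta>'" using \<alpha>(2) by (auto simp: maps_lessThan)
      then show ?thesis using * \<alpha>(1) by simp
    qed
    then show "(\<eta>, \<theta>) \<in> E_reg" unfolding E_reg_iff by blast
  qed
qed simp

lemma sigma11_E_reg: "sigma11 (E_reg :: (('k \<Rightarrow> 'k) \<times> ('k \<Rightarrow> 'k)) set)"
proof -
  define C :: "((('k \<Rightarrow> 'k) \<times> ('k \<Rightarrow> 'k)) \<times> ('k \<Rightarrow> 'k)) set" where
    "C = {((\<eta>, \<xi>), \<zeta>). \<forall>\<alpha>\<in>reg. maps {..<\<alpha>} \<zeta> \<longrightarrow> \<eta> \<alpha> = \<xi> \<alpha>}"
  have "closedin (prod_topology (prod_topology bounded_topology bounded_topology) bounded_topology) C"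
    unfolding closedin_triple_iff
  proof (intro allI impI)
    fix f g h :: "'k \<Rightarrow> 'k"
    assume lim: "\<forall>\<beta>. \<exists>f' g' h'. ((f', g'), h') \<in> C \<and>
        restr f' \<beta> = restr f \<beta> \<and> restr g' \<beta> = restr g \<beta> \<and> restr h' \<beta> = restr h \<beta>"
    have "f \<alpha> = g \<alpha>" if \<alpha>: "\<alpha> \<in> reg" "maps {..<\<alpha>} h" for \<alpha>
    proof -
      \<comment> \<open>The length has to exceed \<alpha>, because the values at \<alpha> itself are
        compared.\<close>
      obtain \<beta> where \<beta>: "\<alpha> < \<beta>" using no_max by blast
      obtain f' g' h' where C: "((f', g'), h') \<in> C" and
        eq: "restr f' \<beta> = restr f \<beta>" "restr g' \<beta> = restr g \<beta>" "restr h' \<beta> = restr h \<beta>"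
        using lim[THEN spec[of _ \<beta>]] by blast
      have "maps {..<\<alpha>} h'"
        using \<alpha>(2) eq(3) \<beta> unfolding maps_lessThan restr_eq_iff by (metis order.strict_trans)
      then have "f' \<alpha> = g' \<alpha>" using C \<alpha>(1) by (simp add: C_def)
      then show ?thesis using eq(1,2) \<beta> unfolding restr_eq_iff by metis
    qed
    then show "((f, g), h) \<in> C" by (simp add: C_def)
  qed
  moreover have "E_reg = fst ` C"
  proof
    show "E_reg \<subseteq> fst ` C"
    proof
      fix p :: "('k \<Rightarrow> 'k) \<times> ('k \<Rightarrow> 'k)" assume "p \<in> E_reg"
      moreover obtain \<eta> \<xi> where p: "p = (\<eta>, \<xi>)" by (cases p)
      ultimately obtain \<zeta> where "((\<eta>, \<xi>), \<zeta>) \<in> C" by (auto simp: E_reg_iff C_def)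
      then show "p \<in> fst ` C" using p by force
    qed
    show "fst ` C \<subseteq> E_reg" unfolding C_def using E_reg_iff by fastforce
  qed
  ultimately show ?thesis unfolding sigma11_def by blast
qed

section \<open>The reduction of an arbitrary \<open>\<Sigma>\<^sup>1\<^sub>1\<close> equivalence
  relation\<close>

lemma borel_reducible_E_reg:
  fixes E :: "(('k \<Rightarrow> 'k) \<times> ('k \<Rightarrow> 'k)) set"
  assumes E: "equiv UNIV E" and "sigma11 E"
  shows "borel_reducible E E_reg"
proof -
  obtain C :: "((('k \<Rightarrow> 'k) \<times> ('k \<Rightarrow> 'k)) \<times> ('k \<Rightarrow> 'k)) set" where closed: "closedin (prod_topology (prod_topology bounded_topology bounded_topology) bounded_topology) C"
    and EC: "E = fst ` C" using \<open>sigma11 E\<close> unfolding sigma11_def by blast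
  \<comment> \<open>The tree of C in terms of codes: three short sequences with a common extension
    in C. As C is closed, its branches are the elements of C.\<close>
  define T where "T s t u \<longleftrightarrow> (\<exists>f g h. ((f, g), h) \<in> C \<and>
    f \<in> basic_open (seq s) \<and> g \<in> basic_open (seq t) \<and> h \<in> basic_open (seq u))" for s t u
  have in_C: "(\<forall>\<beta>. T (num_of f \<beta>) (num_of g \<beta>) (num_of h \<beta>)) \<longleftrightarrow> ((f, g), h) \<in> C" for f g h
  proof
    assume "\<forall>\<beta>. T (num_of f \<beta>) (num_of g \<beta>) (num_of h \<beta>)"
    then have "\<forall>\<beta>. \<exists>f' g' h'. ((f', g'), h') \<in> C \<and>
        restr f' \<beta> = restr f \<beta> \<and> restr g' \<beta> = restr g \<beta> \<and> restr h' \<beta> = restr h \<beta>"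
      by (simp add: T_def)
    then show "((f, g), h) \<in> C"
      by (rule closed[unfolded closedin_triple_iff, THEN spec, THEN spec, THEN spec, THEN mp])
  next
    assume "((f, g), h) \<in> C"
    then show "\<forall>\<beta>. T (num_of f \<beta>) (num_of g \<beta>) (num_of h \<beta>)" unfolding T_def by auto
  qed
  have sim_E: "sim UNIV val T f g \<longleftrightarrow> (f, g) \<in> E" for f g
  proof -
    have "(f, g) \<in> E \<longleftrightarrow> (\<exists>h. ((f, g), h) \<in> C)" unfolding EC by force
    then show ?thesis by (simp add: sim_UNIV in_C)
  qed
  have equiv: "equiv_at UNIV val T"
    using E unfolding equiv_at_def sim_E equiv_def refl_on_def sym_def trans_def by blast
  define cls where "cls \<alpha> f = {g. maps {..<\<alpha>} g \<and> sim {..<\<alpha>} val T f g}" for \<alpha> f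
  \<comment> \<open>The choice sees f only through its class, so equivalent functions get the same
    representative. Where the relation at \<alpha> is not an equivalence, all functions get the same
    default \<alpha>.\<close>
  define F where "F f \<alpha> = (if equiv_at {..<\<alpha>} val T \<and> maps {..<\<alpha>} f
    then num_of (SOME g. g \<in> cls \<alpha> f) \<alpha> else \<alpha>)" for f \<alpha>
  have local: "F f \<alpha> = F g \<alpha>" if "restr f \<alpha> = restr g \<alpha>" for f g \<alpha>
  proof -
    have eq: "f \<gamma> = g \<gamma>" if "\<gamma> \<in> {..<\<alpha>}" for \<gamma> using \<open>restr f \<alpha> = restr g \<alpha>\<close> that by (simp add: restr_eq_iff)
    have "cls \<alpha> f = cls \<alpha> g" unfolding cls_def using sim_cong[of "{..<\<alpha>}" f g] eq by blast
    moreover have "maps {..<\<alpha>} f \<longleftrightarrow> maps {..<\<alpha>} g" using eq by (simp add: maps_lessThan)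
    ultimately show ?thesis by (simp add: F_def)
  qed
  obtain a b :: 'k where "a < b" using no_max by blast
  moreover have "(short_seqs :: ('k \<rightharpoonup> 'k) set) \<approx> (UNIV :: 'k set)"
    using seq eqpoll_sym eqpoll_def by blast
  ultimately have "borel_function F" using borel_function_if_local[of b F] local by blast
  moreover have "(f, g) \<in> E \<longleftrightarrow> (F f, F g) \<in> E_reg" for f g
  proof
    assume "(f, g) \<in> E"
    then obtain h where "((f, g), h) \<in> C" unfolding EC by force
    then have T: "T (num_of f \<beta>) (num_of g \<beta>) (num_of h \<beta>)" for \<beta> using in_C by blast
    \<comment> \<open>If \<alpha> is closed under \<zeta>, then f, g, h map \<alpha> to \<alpha> and
      all codes of their proper restrictions are below \<alpha>, so h witnesses the equivalence at
      \<alpha>.\<close>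
    define \<zeta> where "\<zeta> \<beta> = max (f \<beta>) (max (g \<beta>) (max (h \<beta>)
      (max (num_of f \<beta>) (max (num_of g \<beta>) (num_of h \<beta>)))))" for \<beta>
    have "F f \<alpha> = F g \<alpha>" if "maps {..<\<alpha>} \<zeta>" for \<alpha>
    proof (cases "equiv_at {..<\<alpha>} val T")
      case True
      have maps: "maps {..<\<alpha>} f" "maps {..<\<alpha>} g" "maps {..<\<alpha>} h" "maps {..<\<alpha>} (num_of f)"
        "maps {..<\<alpha>} (num_of g)" "maps {..<\<alpha>} (num_of h)"
        using that by (auto simp: \<zeta>_def maps_lessThan)
      have "wit {..<\<alpha>} val T (graph f) (graph g) (graph h)"
        unfolding wit_def
      proof
        fix \<beta> assume "\<beta> \<in> {..<\<alpha>}"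
        then have "num_of f \<beta> \<in> {..<\<alpha>}" "num_of g \<beta> \<in> {..<\<alpha>}" "num_of h \<beta> \<in> {..<\<alpha>}"
          using maps by (auto simp: maps_def)
        then show "\<exists>s\<in>{..<\<alpha>}. \<exists>t\<in>{..<\<alpha>}. \<exists>u\<in>{..<\<alpha>}. seg {..<\<alpha>} val s \<beta> (graph f) \<and>
            seg {..<\<alpha>} val t \<beta> (graph g) \<and> seg {..<\<alpha>} val u \<beta> (graph h) \<and> T s t u"
          using seg_num_of T by meson
      qed
      then have fg: "sim {..<\<alpha>} val T f g" using maps(3) by (auto simp: sim_def)
      then have "sim {..<\<alpha>} val T f k \<longleftrightarrow> sim {..<\<alpha>} val T g k" if "maps {..<\<alpha>} k" for k
        using equiv_at_sym[OF True] equiv_at_trans[OF True] maps that by meson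
      then have "cls \<alpha> f = cls \<alpha> g" by (auto simp: cls_def)
      then show ?thesis using maps by (simp add: F_def)
    qed (simp add: F_def)
    then show "(F f, F g) \<in> E_reg" unfolding E_reg_iff by blast
  next
    assume "(F f, F g) \<in> E_reg"
    then obtain \<zeta> where \<zeta>: "\<forall>\<alpha>\<in>reg. maps {..<\<alpha>} \<zeta> \<longrightarrow> F f \<alpha> = F g \<alpha>" unfolding E_reg_iff by blast
    show "(f, g) \<in> E"
    proof (rule ccontr)
      assume "(f, g) \<notin> E"
      then have "\<not> sim UNIV val T f g" by (simp add: sim_E)
      then obtain \<alpha> where \<alpha>: "\<alpha> \<in> reg" "maps {..<\<alpha>} \<zeta>" and maps: "maps {..<\<alpha>} f" "maps {..<\<alpha>} g"
        and eq: "equiv_at {..<\<alpha>} val T" and sep: "\<not> sim {..<\<alpha>} val T f g"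
        using reflect_reg[OF equiv, of f g \<zeta>] by blast
      define f' g' where "f' = (SOME k. k \<in> cls \<alpha> f)" and "g' = (SOME k. k \<in> cls \<alpha> g)"
      have "sim {..<\<alpha>} val T f f" "sim {..<\<alpha>} val T g g" using eq maps unfolding equiv_at_def by blast+
      then have f: "f \<in> cls \<alpha> f" and g: "g \<in> cls \<alpha> g" using maps by (simp_all add: cls_def)
      have "f' \<in> cls \<alpha> f" unfolding f'_def using f by (auto simp: some_in_eq)
      moreover have "g' \<in> cls \<alpha> g" unfolding g'_def using g by (auto simp: some_in_eq)
      ultimately have f': "maps {..<\<alpha>} f'" "sim {..<\<alpha>} val T f f'" and g': "maps {..<\<alpha>} g'" "sim {..<\<alpha>} val T g g'"
        by (auto simp: cls_def)
      have "F f \<alpha> = F g \<alpha>" using \<zeta> \<alpha> by blast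
      \<comment> \<open>Equal codes mean that the two representatives agree below \<alpha>. Since
        \<open>sim\<close> looks only there, f' would be equivalent to both f and g.\<close>
      then have "num_of f' \<alpha> = num_of g' \<alpha>" using eq maps by (simp add: F_def f'_def g'_def)
      then have "\<forall>\<gamma><\<alpha>. f' \<gamma> = g' \<gamma>" by (simp add: num_of_eq_iff restr_eq_iff)
      then have "sim {..<\<alpha>} val T g f'" using g'(2) sim_cong[of "{..<\<alpha>}" g g f' g'] by simp
      then have "sim {..<\<alpha>} val T f g"
        using f' maps equiv_at_sym[OF eq] equiv_at_trans[OF eq] by meson
      then show False using sep by blast
    qed
  qed
  ultimately show ?thesis unfolding borel_reducible_def by blast
qed

end

text \<open>An infinite cardinal has no last element, so \<kappa> only has to be shown infinite.
  Reflecting that the domain is nonempty gives a nonzero ordinal below \<kappa>, and then a finite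
  \<kappa> has fewer elements than short sequences.\<close>

lemma no_max_if_indescribable:
  fixes elts :: "'v \<Rightarrow> 'v set" and V :: "'k::wellorder \<Rightarrow> 'v set"
  assumes card: "is_cardinal_type TYPE('k)"
    and short: "(short_seqs :: ('k \<rightharpoonup> 'k) set) \<approx> (UNIV :: 'k set)"
    and hier: "cumulative_hierarchy elts V" and ind: "pi1_indescribable 2 elts V"
  shows "\<exists>\<beta>. (\<alpha>'::'k) < \<beta>"
proof -
  define \<phi> where "\<phi> = Exists1 0 (Eq 0 0)"
  have "pi1 2 \<phi>"
  proof -
    have "pi1 (Suc (Suc 0)) \<phi>" by (intro pi1_incl sigma1_incl pi1_base) (simp add: \<phi>_def)
    then show ?thesis by (simp add: numeral_2_eq_2)
  qed
  moreover have "sentence \<phi>" "models elts UNIV {} \<phi>" by (auto simp: \<phi>_def sentence_def models_def)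
  ultimately obtain \<alpha> where "models elts (V \<alpha>) ({} \<inter> V \<alpha>) \<phi>" using ind unfolding pi1_indescribable_def by blast
  then have "V \<alpha> \<noteq> {}" by (auto simp: \<phi>_def models_def)
  then obtain z0 where z0: "z0 < \<alpha>" using hier unfolding cumulative_hierarchy_def by blast
  \<comment> \<open>The ordinals 0 and 1, so that the maps with domain {z} are the sequences of
    length one.\<close>
  define z :: 'k where "z = (LEAST x. True)"
  define b where "b = (LEAST x. z < x)"
  have z: "z \<le> x" for x unfolding z_def by (rule Least_le) simp
  then have "z < \<alpha>" using z0 by (meson le_less_trans)
  then have b: "z < b" unfolding b_def by (rule LeastI)
  have below_b: "{..<b} = {z}"
  proof -
    have "x = z" if "x < b" for x
    proof -
      have "\<not> z < x" using not_less_Least that unfolding b_def by blast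
      then show ?thesis using z[of x] by simp
    qed
    then show ?thesis using b by blast
  qed
  have no_z: "{..<z} = {}" using z leD by blast
  \<comment> \<open>The empty sequence and the sequences of length one are too many for a finite \<open>\<kappa>\<close>.\<close>
  have "infinite (UNIV :: 'k set)"
  proof
    assume fin: "finite (UNIV :: 'k set)"
    obtain p where p: "bij_betw p (short_seqs :: ('k \<rightharpoonup> 'k) set) (UNIV :: 'k set)"
      using short unfolding eqpoll_def by blast
    have single: "[z \<mapsto> a] \<in> short_seqs" for a :: 'k
      unfolding short_seqs_def using below_b by auto
    have empty: "Map.empty \<in> (short_seqs :: ('k \<rightharpoonup> 'k) set)"
      unfolding short_seqs_def using no_z by auto
    have "inj (\<lambda>a. p [z \<mapsto> a])"
    proof (rule injI)
      fix a a' assume "p [z \<mapsto> a] = p [z \<mapsto> a']"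
      then have "[z \<mapsto> a] = [z \<mapsto> a']" using p single unfolding bij_betw_def by (meson inj_onD)
      then show "a = a'" by (metis fun_upd_same option.inject)
    qed
    then have "surj (\<lambda>a. p [z \<mapsto> a])" using fin by (simp add: finite_UNIV_inj_surj)
    from surjD[OF this] obtain a where "p Map.empty = p [z \<mapsto> a]" by blast
    then have "Map.empty = [z \<mapsto> a]" using p single empty unfolding bij_betw_def by (meson inj_onD)
    then show False by (metis fun_upd_same option.distinct(1))
  qed
  moreover have Field: "Field {(x::'k, y). x \<le> y} = UNIV" by (auto simp: Field_def)
  ultimately have "infinite (Field {(x::'k, y). x \<le> y})" by simp
  moreover have "Card_order {(x::'k, y). x \<le> y}"
    using card card_order_on_Card_order unfolding is_cardinal_type_def by blast
  moreover have "\<alpha>' \<in> Field {(x::'k, y). x \<le> y}" by (simp add: Field)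
  ultimately obtain \<beta> where "\<alpha>' \<noteq> \<beta>" "(\<alpha>', \<beta>) \<in> {(x::'k, y). x \<le> y}"
    using infinite_Card_order_limit by meson
  then have "\<alpha>' < \<beta>" by simp
  then show ?thesis ..
qed

theorem theorem3p7:
  fixes elts :: "'v \<Rightarrow> 'v set"
    and V :: "'k::wellorder \<Rightarrow> 'v set"
  assumes "is_cardinal_type TYPE('k)"
    and "(short_seqs :: ('k \<rightharpoonup> 'k) set) \<approx> (UNIV :: 'k set)"
    and "cumulative_hierarchy elts V"
    and "pi1_indescribable 2 elts V"
  shows "sigma11_complete (E_reg :: (('k \<Rightarrow> 'k) \<times> ('k \<Rightarrow> 'k)) set)"
proof -
  obtain seq :: "'k \<Rightarrow> ('k \<rightharpoonup> 'k)" where "bij_betw seq UNIV short_seqs"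
    using assms(2) eqpoll_sym eqpoll_def by blast
  moreover have "Well_order {(x::'k, y). x \<le> y}"
    using assms(1) card_order_on_Card_order card_order_on_well_order_on
    unfolding is_cardinal_type_def by blast
  ultimately interpret indescribable elts V seq
    using assms no_max_if_indescribable[OF assms] by unfold_locales
  show ?thesis
    unfolding sigma11_complete_def
    using equiv_E_reg sigma11_E_reg borel_reducible_E_reg by blast
qed

end
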